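(* For all positive integers $d,k$, $$\xi_{d,k}\ \ge\ \left(\frac{\sqrt{d^2+k^2}+k}{d}\right)^{\frac{d}{2(d+k)}}\left(\frac{\sqrt{d^2+k^2}+d}{k}\right)^{\frac{k}{2(d+k)}}.$$
   Context: For positive integers $d,k$, $\Xi_{d,k}$ denotes the maximal possible number of non-degenerate solutions in $\mathbb R_{>0}^d$ of a polynomial system $f_1=\dots=f_d=0$ with $f_1,\dots,f_d\in\mathbb R[X_1,\dots,X_d]$ that involves altogether at most $d+k+1$ distinct monomials with nonzero coefficients (this maximum is finite). Non-degenerate means that the Jacobian matrix of the system is invertible at the solution. For positive integers $d,k$, $\xi_{d,k}:=\lim_{n\to\infty}(\Xi_{dn,kn})^{1/(dn+kn)}\in[1,\infty]$; this limit is known to exist. *)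

theory Defs
  imports
    "HOL-Analysis.Analysis"
    "HOL-Library.Poly_Mapping"
    "HOL-Library.Extended_Nat"
    "HOL-Library.Extended_Real"
    "Jordan_Normal_Form.Matrix"
begin

text \<open>
  A real polynomial in variables indexed by natural numbers is a finitely supported map from
  monomials (finitely supported exponent vectors) to coefficients, so that \<open>keys p\<close> is the set of
  monomials occurring in \<open>p\<close> with nonzero coefficient.
\<close>

type_synonym rmpoly = "(nat \<Rightarrow>\<^sub>0 nat) \<Rightarrow>\<^sub>0 real"

definition polys_in :: "nat \<Rightarrow> rmpoly set" where
  "polys_in d = {p. \<forall>m \<in> Poly_Mapping.keys p. Poly_Mapping.keys m \<subseteq> {..<d}}"

definition poly_eval :: "rmpoly \<Rightarrow> (nat \<Rightarrow> real) \<Rightarrow> real" where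
  "poly_eval p x =
     (\<Sum>m \<in> Poly_Mapping.keys p. Poly_Mapping.lookup p m *
        (\<Prod>i \<in> Poly_Mapping.keys m. x i ^ Poly_Mapping.lookup m i))"

definition jacobian :: "nat \<Rightarrow> (nat \<Rightarrow> rmpoly) \<Rightarrow> (nat \<Rightarrow> real) \<Rightarrow> real Matrix.mat" where
  "jacobian d f x =
     Matrix.mat d d (\<lambda>(i, j). deriv (\<lambda>t. poly_eval (f i) (x(j := t))) (x j))"

text \<open>
  Points of the positive orthant of dimension \<open>d\<close> are extensional functions on \<open>{..<d}\<close>, so distinct
  functions are distinct points and counting them is meaningful. Only the components \<open>f i\<close> with
  \<open>i < d\<close> of a system \<open>f\<close> matter.
\<close>

definition nondeg_pos_solutions :: "nat \<Rightarrow> (nat \<Rightarrow> rmpoly) \<Rightarrow> (nat \<Rightarrow> real) set" where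
  "nondeg_pos_solutions d f =
     {x \<in> {..<d} \<rightarrow>\<^sub>E {0<..}. (\<forall>i<d. poly_eval (f i) x = 0) \<and> invertible_mat (jacobian d f x)}"

definition sparse_systems :: "nat \<Rightarrow> nat \<Rightarrow> (nat \<Rightarrow> rmpoly) set" where
  "sparse_systems d k =
     {f. (\<forall>i<d. f i \<in> polys_in d) \<and> card (\<Union>i<d. Poly_Mapping.keys (f i)) \<le> d + k + 1}"

definition ecard :: "'a set \<Rightarrow> enat" where
  "ecard A = (if finite A then enat (card A) else \<infinity>)"

text \<open>
  The maximum is taken as a supremum of extended naturals. It is finite, hence attained, by
  Khovanskii's theorem on fewnomials, but the definition does not depend on that theorem.
\<close>

definition Xi :: "nat \<Rightarrow> nat \<Rightarrow> enat" where
  "Xi d k = (SUP f \<in> sparse_systems d k. ecard (nondeg_pos_solutions d f))"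

text \<open>Used only with a positive exponent, hence the value at infinity.\<close>

definition enat_powr :: "enat \<Rightarrow> real \<Rightarrow> ereal" where
  "enat_powr N a = (case N of enat m \<Rightarrow> ereal (real m powr a) | \<infinity> \<Rightarrow> \<infinity>)"

definition xi :: "nat \<Rightarrow> nat \<Rightarrow> ereal" where
  "xi d k = lim (\<lambda>n. enat_powr (Xi (d * n) (k * n)) (1 / real (d * n + k * n)))"

end

theory Submission
  imports
    Defs
    "Jordan_Normal_Form.Determinant"
    "HOL-Combinatorics.Multiset_Permutations"
begin

text \<open>
  Supermultiplicativity of \<open>Xi\<close> and Fekete's lemma show that \<open>xi d k\<close> bounds every term of its
  defining sequence, so it suffices to produce systems with many solutions. Take monomials
  \<open>x\<^sub>1 ^ t * x\<^sub>2 ^ (t\<^sup>2) * \<dots> * x\<^sub>d ^ (t\<^sup>d)\<close>, weighted by \<open>exp (- L * t ^ (d + 1))\<close> with \<open>L\<close> large, and as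
  linear equations the condition that the weighted monomials, listed in a second order of the nodes,
  are the values of a polynomial of degree at most \<open>k\<close>. Positive solutions then correspond to pairs
  of polynomials with \<open>P (s p) = exp (Q (t p))\<close> at all \<open>d + k + 1\<close> nodes. If \<open>B\<close> is a set of
  \<open>k\<close> nodes satisfying Gale's evenness condition in the second order and its complement \<open>A\<close> satisfies it
  in the first, then \<open>P \<approx> \<Prod>b\<in>B. s - s b\<close> and \<open>Q \<approx> - L * (\<Prod>a\<in>A. t - t a)\<close> can be corrected to an
  exact nondegenerate solution by a contraction argument. With the second order obtained from the
  first by swapping neighbours, such sets \<open>B\<close> are encoded by Delannoy paths, and the bound is the
  growth rate of the number of these paths.
\<close>

subsection \<open>Lagrange interpolation and the contraction argument\<close>

text \<open>Nodes are given by an index set \<open>S\<close> and a map \<open>z\<close>, because the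
  same indices later carry two families of nodes, \<open>s\<close> and \<open>t\<close>.\<close>

definition lagrange_basis :: "('a \<Rightarrow> real) \<Rightarrow> 'a set \<Rightarrow> 'a \<Rightarrow> real poly" where
  "lagrange_basis z S b = (\<Prod>c\<in>S - {b}. Polynomial.smult (1 / (z b - z c)) [:- z c, 1:])"

definition interpolant :: "('a \<Rightarrow> real) \<Rightarrow> 'a set \<Rightarrow> ('a \<Rightarrow> real) \<Rightarrow> real poly" where
  "interpolant z S v = (\<Sum>b\<in>S. Polynomial.smult (v b) (lagrange_basis z S b))"

definition nodal_poly :: "('a \<Rightarrow> real) \<Rightarrow> 'a set \<Rightarrow> real poly" where
  "nodal_poly z S = (\<Prod>c\<in>S. [:- z c, 1:])"

lemma poly_nodal_poly: "poly (nodal_poly z S) u = (\<Prod>c\<in>S. u - z c)"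
  by (simp add: nodal_poly_def poly_prod)

lemma degree_nodal_poly: "degree (nodal_poly z S) = card S"
  unfolding nodal_poly_def by (subst degree_prod_eq_sum_degree) auto

lemma coeff_nodal_poly: "poly.coeff (nodal_poly z S) (card S) = 1"
proof -
  have "lead_coeff (nodal_poly z S) = 1" by (simp add: nodal_poly_def lead_coeff_prod)
  thus ?thesis by (simp add: degree_nodal_poly)
qed

lemma poly_lagrange_basis_eq: "poly (lagrange_basis z S b) u = (\<Prod>c\<in>S - {b}. (u - z c) / (z b - z c))"
  unfolding lagrange_basis_def poly_prod by (intro prod.cong refl) (simp add: diff_divide_distrib)

lemma poly_lagrange_basis:
  assumes "finite S" "inj_on z S" "a \<in> S" "b \<in> S"
  shows "poly (lagrange_basis z S b) (z a) = (if a = b then 1 else 0)"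
proof (cases "a = b")
  case True
  have "z a \<noteq> z c" if "c \<in> S - {a}" for c using assms that by (auto dest: inj_onD)
  thus ?thesis using True by (auto simp: poly_lagrange_basis_eq intro!: prod.neutral)
next
  case False
  thus ?thesis using assms by (auto simp: poly_lagrange_basis_eq)
qed

lemma degree_lagrange_basis:
  assumes "finite S" "b \<in> S"
  shows "degree (lagrange_basis z S b) < card S"
proof -
  have "degree (lagrange_basis z S b) \<le> (\<Sum>c\<in>S - {b}. degree (Polynomial.smult (1 / (z b - z c)) [:- z c, 1:]))"
    unfolding lagrange_basis_def using assms
    by (intro order_trans[OF degree_prod_sum_le]) (simp_all only: o_def finite_Diff order_refl)
  also have "\<dots> \<le> card (S - {b})" unfolding card_eq_sum by (intro sum_mono) (simp add: degree_smult_le)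
  also have "\<dots> < card S" using assms by (rule card_Diff1_less)
  finally show ?thesis .
qed

lemma poly_interpolant:
  "poly (interpolant z S v) u = (\<Sum>b\<in>S. v b * poly (lagrange_basis z S b) u)"
  by (simp add: interpolant_def poly_sum)

lemma poly_interpolant_node:
  assumes "finite S" "inj_on z S" "a \<in> S"
  shows "poly (interpolant z S v) (z a) = v a"
proof -
  have "poly (interpolant z S v) (z a) = (\<Sum>b\<in>S. if a = b then v b else 0)"
    unfolding poly_interpolant using assms by (intro sum.cong) (auto simp: poly_lagrange_basis)
  with assms show ?thesis by simp
qed

lemma coeff_interpolant:
  assumes "finite S" "card S \<le> m"
  shows "poly.coeff (interpolant z S v) m = 0"
proof -
  have "poly.coeff (lagrange_basis z S b) m = 0" if "b \<in> S" for b
    using degree_lagrange_basis[OF assms(1) that, of z] assms(2) by (intro coeff_eq_0) simp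
  thus ?thesis by (simp add: interpolant_def coeff_sum)
qed

text \<open>The difference from the interpolant has \<open>card S\<close> roots and smaller degree.
  Bounding coefficients instead of the degree makes the hypothesis mean \<open>p = 0\<close> for
  empty \<open>S\<close>, a case that arises for \<open>B\<close> when \<open>k = 0\<close>.\<close>

lemma poly_eq_interpolation:
  assumes S: "finite S" "inj_on z S" and p: "\<And>m. m \<ge> card S \<Longrightarrow> poly.coeff p m = 0"
  shows "poly p u = (\<Sum>b\<in>S. poly p (z b) * poly (lagrange_basis z S b) u)"
proof -
  define q where "q = p - interpolant z S (\<lambda>b. poly p (z b))"
  have c: "poly.coeff q m = 0" if "m \<ge> card S" for m
    using p that S by (simp add: q_def coeff_interpolant)
  have "q = 0"
  proof (rule ccontr)
    assume "q \<noteq> 0"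
    hence "poly.coeff q (degree q) \<noteq> 0" by simp
    hence "degree q < card S" using c by (meson not_le)
    also have "card S = card (z ` S)" using S by (simp add: card_image)
    also have "\<dots> \<le> card {x. poly q x = 0}"
      using S \<open>q \<noteq> 0\<close> by (intro card_mono poly_roots_finite) (auto simp: q_def poly_interpolant_node)
    also have "\<dots> \<le> degree q" by (rule card_poly_roots_bound) fact
    finally show False by simp
  qed
  thus ?thesis by (simp add: q_def flip: poly_interpolant)
qed

text \<open>Banach's fixed point theorem for the maximum norm on the box
  \<open>[0, \<eta>]^S\<close>, by iteration from the zero function. Points are functions on the
  whole type of which only the values on \<open>S\<close> count, and limits are taken
  coordinatewise.\<close>

lemma box_fixpoint:
  fixes F :: "('a \<Rightarrow> real) \<Rightarrow> 'a \<Rightarrow> real"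
  assumes fin: "finite S" and \<eta>: "\<eta> \<ge> 0"
    and box: "\<And>x b. (\<And>b. b \<in> S \<Longrightarrow> x b \<in> {0..\<eta>}) \<Longrightarrow> b \<in> S \<Longrightarrow> F x b \<in> {0..\<eta>}"
    and lip: "\<And>x y \<rho> b. (\<And>b. b \<in> S \<Longrightarrow> x b \<in> {0..\<eta>}) \<Longrightarrow> (\<And>b. b \<in> S \<Longrightarrow> y b \<in> {0..\<eta>}) \<Longrightarrow>
       (\<And>b. b \<in> S \<Longrightarrow> \<bar>x b - y b\<bar> \<le> \<rho>) \<Longrightarrow> b \<in> S \<Longrightarrow> \<bar>F x b - F y b\<bar> \<le> \<rho> / 2"
  obtains x where "\<And>b. b \<in> S \<Longrightarrow> x b \<in> {0..\<eta>}" "\<And>b. b \<in> S \<Longrightarrow> F x b = x b"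
proof -
  define X where "X = (\<lambda>m. (F ^^ m) (\<lambda>_. 0))"
  have X_Suc: "X (Suc m) = F (X m)" for m by (simp add: X_def)
  have X_box: "b \<in> S \<Longrightarrow> X m b \<in> {0..\<eta>}" for m b
  proof (induction m arbitrary: b)
    case 0
    show ?case using \<eta> by (simp add: X_def)
  next
    case (Suc m)
    thus ?case unfolding X_Suc by (intro box)
  qed
  have diff: "b \<in> S \<Longrightarrow> \<bar>X (Suc m) b - X m b\<bar> \<le> \<eta> * (1 / 2) ^ m" for m b
  proof (induction m arbitrary: b)
    case 0
    thus ?case using X_box[of b 0] X_box[of b "Suc 0"]
      unfolding atLeastAtMost_iff power_0 mult_1_right by linarith
  next
    case (Suc m)
    have "\<bar>F (X (Suc m)) b - F (X m) b\<bar> \<le> \<eta> * (1 / 2) ^ m / 2"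
      by (intro lip X_box Suc)
    thus ?case by (simp add: X_Suc)
  qed
  have conv: "convergent (\<lambda>m. X m b)" if "b \<in> S" for b
  proof -
    have "summable (\<lambda>m. X (Suc m) b - X m b)"
    proof (rule summable_comparison_test')
      show "summable (\<lambda>m. \<eta> * (1 / 2 :: real) ^ m)" by (intro summable_mult summable_geometric) simp
      show "norm (X (Suc m) b - X m b) \<le> \<eta> * (1 / 2) ^ m" if "m \<ge> 0" for m
        using diff[OF \<open>b \<in> S\<close>] by simp
    qed
    hence "convergent (\<lambda>m. \<Sum>i<m. X (Suc i) b - X i b)" by (simp add: summable_iff_convergent)
    hence "convergent (\<lambda>m. X m b - X 0 b)" 
      by (simp only: sum_lessThan_telescope[of "\<lambda>i. X i b"])
    from convergent_add[OF this convergent_const[of "X 0 b"]] show ?thesis by simp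
  qed
  define l where "l = (\<lambda>b. lim (\<lambda>m. X m b))"
  have lim: "(\<lambda>m. X m b) \<longlonglongrightarrow> l b" if "b \<in> S" for b
    using conv[OF that] by (simp add: l_def convergent_LIMSEQ_iff)
  have l_box: "l b \<in> {0..\<eta>}" if "b \<in> S" for b
    using closed_sequentially[OF _ _ lim[OF that], of "{0..\<eta>}"] X_box[OF that] by auto
  have "F l b = l b" if b: "b \<in> S" for b
  proof -
    have "(\<lambda>m. (\<Sum>c\<in>S. \<bar>X m c - l c\<bar>) / 2) \<longlonglongrightarrow> (\<Sum>c\<in>S. \<bar>l c - l c\<bar>) / 2"
      by (intro tendsto_intros lim) auto
    hence "(\<lambda>m. (\<Sum>c\<in>S. \<bar>X m c - l c\<bar>) / 2) \<longlonglongrightarrow> 0" by simp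
    moreover have "norm (F (X m) b - F l b) \<le> (\<Sum>c\<in>S. \<bar>X m c - l c\<bar>) / 2" for m
      unfolding real_norm_def using fin by (intro lip X_box l_box b member_le_sum) auto
    ultimately have "(\<lambda>m. F (X m) b - F l b) \<longlonglongrightarrow> 0"
      by (rule Lim_null_comparison[OF always_eventually[OF allI], rotated])
    hence "(\<lambda>m. F (X m) b) \<longlonglongrightarrow> F l b" by (simp add: LIM_zero_iff)
    moreover have "(\<lambda>m. F (X m) b) \<longlonglongrightarrow> l b" using LIMSEQ_Suc[OF lim[OF b]] by (simp add: X_Suc)
    ultimately show ?thesis by (rule LIMSEQ_unique)
  qed
  with l_box that show ?thesis by blast
qed

lemma abs_exp_diff_le:
  fixes y z c :: real
  assumes "y \<le> c" "z \<le> c"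
  shows "\<bar>exp y - exp z\<bar> \<le> exp c * \<bar>y - z\<bar>"
proof -
  have *: "exp v - exp u \<le> exp c * (v - u)" if "u \<le> v" "v \<le> c" for u v
  proof -
    have "exp v - exp u = exp v * (1 - exp (u - v))" by (simp add: exp_diff algebra_simps)
    also have "\<dots> \<le> exp v * (v - u)"
      using exp_ge_add_one_self[of "u - v"] by (intro mult_left_mono) (linarith, simp)
    also have "\<dots> \<le> exp c * (v - u)" using that by (intro mult_right_mono) auto
    finally show ?thesis .
  qed
  show ?thesis
    using *[of y z] *[of z y] assms by (cases "y \<le> z") auto
qed

lemma abs_ln_diff_le:
  fixes u v c :: real
  assumes "c > 0" "c \<le> u" "c \<le> v"
  shows "\<bar>ln u - ln v\<bar> \<le> \<bar>u - v\<bar> / c"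
proof -
  have *: "ln y - ln x \<le> (y - x) / c" if "c \<le> x" "x \<le> y" for x y
  proof -
    have "ln y - ln x \<le> (y - x) / x" using that assms by (intro ln_diff_le) auto
    also have "\<dots> \<le> (y - x) / c" using that assms by (intro divide_left_mono) auto
    finally show ?thesis .
  qed
  have mono: "x > 0 \<Longrightarrow> x \<le> y \<Longrightarrow> ln x \<le> ln y" for x y :: real by simp
  show ?thesis
    using *[of u v] *[of v u] mono[of u v] mono[of v u] assms by (cases "u \<le> v") auto
qed

lemma abs_sum_mult_le:
  fixes f g :: "'a \<Rightarrow> real"
  assumes "\<And>i. i \<in> S \<Longrightarrow> \<bar>g i\<bar> \<le> \<rho>" "(\<Sum>i\<in>S. \<bar>f i\<bar>) \<le> K" "\<rho> \<ge> 0"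
  shows "\<bar>\<Sum>i\<in>S. f i * g i\<bar> \<le> K * \<rho>"
proof -
  have "\<bar>\<Sum>i\<in>S. f i * g i\<bar> \<le> (\<Sum>i\<in>S. \<bar>f i\<bar> * \<bar>g i\<bar>)"
    by (rule order_trans[OF sum_abs]) (simp add: abs_mult)
  also have "\<dots> \<le> (\<Sum>i\<in>S. \<bar>f i\<bar>) * \<rho>"
    unfolding sum_distrib_right using assms by (intro sum_mono mult_left_mono) auto
  also have "\<dots> \<le> K * \<rho>" using assms by (intro mult_right_mono)
  finally show ?thesis .
qed

text \<open>\<open>P\<close> is the nodal polynomial of \<open>B\<close> plus the interpolant of
  small values \<open>\<delta>\<close> on \<open>B\<close>, and \<open>Q\<close> is
  \<open>- L\<close> times the nodal polynomial of \<open>A\<close> plus the interpolant of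
  \<open>ln P\<close> on \<open>A\<close>. The equations on \<open>A\<close> then hold by
  construction, and those on \<open>B\<close> say that \<open>\<delta>\<close> is a fixed point of a
  map that is a contraction for large \<open>L\<close>. The strict inequality will tell solutions
  for different \<open>B\<close> apart. The last clause is nondegeneracy: variations
  \<open>V\<close> of \<open>Q\<close> with fixed top coefficient and \<open>R\<close> of
  \<open>P\<close> solve the linearized equations only if \<open>V\<close> is constant, which
  reflects the rescaling of \<open>P\<close>.\<close>

lemma exp_interpolation:
  fixes s t :: "'a \<Rightarrow> real"
  assumes fin: "finite A" "finite B"
    and inj: "inj_on s B" "inj_on t A"
    and card: "card A = Suc d" "card B = k"
    and pos_t: "\<And>b. b \<in> B \<Longrightarrow> (\<Prod>a\<in>A. t b - t a) > 0"
    and pos_s: "\<And>a. a \<in> A \<Longrightarrow> (\<Prod>b\<in>B. s a - s b) > 0"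
  shows "\<exists>L0. \<forall>L\<ge>L0. \<exists>P Q. degree P \<le> k \<and> degree Q \<le> Suc d \<and> poly.coeff Q (Suc d) = - L \<and>
    (\<forall>p\<in>A \<union> B. poly P (s p) = exp (poly Q (t p))) \<and>
    (\<forall>a\<in>A. \<forall>b\<in>B. poly P (s b) < poly P (s a)) \<and>
    (\<forall>V R. degree V \<le> d \<longrightarrow> degree R \<le> k \<longrightarrow>
       (\<forall>p\<in>A \<union> B. poly V (t p) * poly P (s p) = poly R (s p)) \<longrightarrow> degree V = 0)"
proof -
  define w where "w = (\<lambda>a. \<Prod>b\<in>B. s a - s b)"
  define w' where "w' = (\<lambda>b. \<Prod>a\<in>A. t b - t a)"
  define \<alpha> where "\<alpha> = (\<lambda>a b. poly (lagrange_basis s B b) (s a))"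
  define \<beta> where "\<beta> = (\<lambda>b a. poly (lagrange_basis t A a) (t b))"
  obtain w0 where w0: "w0 > 0" "\<And>a. a \<in> A \<Longrightarrow> w0 \<le> w a" "\<And>b. b \<in> B \<Longrightarrow> w0 \<le> w' b"
  proof
    let ?S = "insert 1 (w ` A \<union> w' ` B)"
    show "Min ?S > 0" using fin pos_s pos_t by (auto simp: w_def w'_def)
    show "a \<in> A \<Longrightarrow> Min ?S \<le> w a" for a using fin by (intro Min_le) auto
    show "b \<in> B \<Longrightarrow> Min ?S \<le> w' b" for b using fin by (intro Min_le) auto
  qed
  obtain K where K: "K \<ge> 1" "\<And>a. a \<in> A \<Longrightarrow> (\<Sum>b\<in>B. \<bar>\<alpha> a b\<bar>) \<le> K"
      "\<And>b. b \<in> B \<Longrightarrow> (\<Sum>a\<in>A. \<bar>\<beta> b a\<bar>) \<le> K"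
  proof
    let ?S = "insert 1 ((\<lambda>a. \<Sum>b\<in>B. \<bar>\<alpha> a b\<bar>) ` A \<union> (\<lambda>b. \<Sum>a\<in>A. \<bar>\<beta> b a\<bar>) ` B)"
    show "Max ?S \<ge> 1" using fin by (intro Max_ge) auto
    show "a \<in> A \<Longrightarrow> (\<Sum>b\<in>B. \<bar>\<alpha> a b\<bar>) \<le> Max ?S" for a using fin by (intro Max_ge) auto
    show "b \<in> B \<Longrightarrow> (\<Sum>a\<in>A. \<bar>\<beta> b a\<bar>) \<le> Max ?S" for b using fin by (intro Max_ge) auto
  qed
  obtain W where W: "\<And>a. a \<in> A \<Longrightarrow> w a \<le> W"
  proof
    show "a \<in> A \<Longrightarrow> w a \<le> Max (w ` A)" for a using fin by (intro Max_ge) auto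
  qed
  \<comment> \<open>Chosen so that \<open>K * \<eta>\<close> is at most a quarter of
    \<open>w0\<close>, which keeps \<open>P\<close> positive on \<open>A\<close>, and so that the
    map on \<open>\<delta>\<close> gets the Lipschitz bound \<open>1 / 2\<close>.\<close>
  define \<eta> where "\<eta> = w0 / (4 * K\<^sup>2)"
  have \<eta>: "\<eta> > 0" using w0 K by (simp add: \<eta>_def)
  have K\<eta>: "K * \<eta> \<le> w0 / 4"
  proof -
    have "K * \<eta> = w0 / 4 / K" using K by (simp add: \<eta>_def power2_eq_square)
    also have "\<dots> \<le> w0 / 4" using K w0 by (simp add: divide_le_eq)
    finally show ?thesis .
  qed
  have \<eta>w0: "\<eta> \<le> w0 / 4"
  proof -
    have "1 * \<eta> \<le> K * \<eta>" using K \<eta> by (intro mult_right_mono) auto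
    with K\<eta> show ?thesis by simp
  qed
  have half: "\<eta> * (K * (K * \<rho> / (w0 / 2))) = \<rho> / 2" for \<rho>
    using w0 K by (simp add: \<eta>_def power2_eq_square)
  \<comment> \<open>\<open>u \<delta> a\<close> is the value of \<open>P\<close> at
    \<open>s a\<close> when \<open>P\<close> takes the values \<open>\<delta>\<close> on
    \<open>B\<close>.\<close>
  define u where "u = (\<lambda>\<delta> a. w a + (\<Sum>b\<in>B. \<alpha> a b * \<delta> b))"
  have u_bounds: "w0 / 2 \<le> u \<delta> a" "u \<delta> a \<le> W + w0"
    if "\<And>b. b \<in> B \<Longrightarrow> \<delta> b \<in> {0..\<eta>}" "a \<in> A" for \<delta> a
  proof -
    have "\<bar>\<Sum>b\<in>B. \<alpha> a b * \<delta> b\<bar> \<le> K * \<eta>"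
      using that K \<eta> by (intro abs_sum_mult_le) auto
    with K\<eta> w0(1) w0(2)[OF that(2)] W[OF that(2)] show "w0 / 2 \<le> u \<delta> a" "u \<delta> a \<le> W + w0"
      unfolding u_def by linarith+
  qed
  define M where "M = \<bar>ln (w0 / 2)\<bar> + \<bar>ln (W + w0)\<bar>"
  have ln_u: "\<bar>ln (u \<delta> a)\<bar> \<le> M" if "\<And>b. b \<in> B \<Longrightarrow> \<delta> b \<in> {0..\<eta>}" "a \<in> A" for \<delta> a
  proof -
    have "w0 / 2 \<le> u \<delta> a" "u \<delta> a \<le> W + w0" using u_bounds[of \<delta> a] that by auto
    hence "ln (w0 / 2) \<le> ln (u \<delta> a)" "ln (u \<delta> a) \<le> ln (W + w0)"
      using w0(1) by (subst ln_le_cancel_iff; linarith)+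
    thus ?thesis unfolding M_def by linarith
  qed
  \<comment> \<open>For \<open>L\<close> beyond this value the term \<open>- L * w' b\<close>
    outweighs the interpolated logarithms, so that the map sends the box into itself.\<close>
  define L0 where "L0 = (K * M - ln \<eta>) / w0"
  show ?thesis
  proof (intro exI[of _ "max 0 L0"] allI impI)
    fix L assume "max 0 L0 \<le> L"
    hence L: "L \<ge> 0" "L0 \<le> L" by auto
    have L': "- L * w0 + K * M \<le> ln \<eta>" using L(2) w0 by (simp add: L0_def field_simps)
    \<comment> \<open>\<open>Y \<delta> b\<close> is the value of \<open>Q\<close> at
      \<open>t b\<close>, so the equation at \<open>b\<close> reads
      \<open>exp (Y \<delta> b) = \<delta> b\<close>.\<close>
    define Y where "Y = (\<lambda>\<delta> b. - L * w' b + (\<Sum>a\<in>A. \<beta> b a * ln (u \<delta> a)))"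
    have Y_le: "Y \<delta> b \<le> ln \<eta>" if "\<And>b. b \<in> B \<Longrightarrow> \<delta> b \<in> {0..\<eta>}" "b \<in> B" for \<delta> b
    proof -
      have "M \<ge> 0" by (simp add: M_def)
      hence "\<bar>\<Sum>a\<in>A. \<beta> b a * ln (u \<delta> a)\<bar> \<le> K * M"
        using that K ln_u by (intro abs_sum_mult_le) auto
      moreover have "- L * w' b \<le> - L * w0" using L w0(3)[OF that(2)] by (simp add: mult_left_mono)
      ultimately show ?thesis using L' unfolding Y_def by linarith
    qed
    obtain \<delta> where \<delta>: "\<And>b. b \<in> B \<Longrightarrow> \<delta> b \<in> {0..\<eta>}" "\<And>b. b \<in> B \<Longrightarrow> exp (Y \<delta> b) = \<delta> b"
    proof (rule box_fixpoint[OF fin(2), of \<eta> "\<lambda>\<delta> b. exp (Y \<delta> b)"])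
      show "exp (Y \<delta> b) \<in> {0..\<eta>}" if "\<And>b. b \<in> B \<Longrightarrow> \<delta> b \<in> {0..\<eta>}" "b \<in> B" for \<delta> b
        using Y_le[OF that] \<eta> by (simp add: exp_le_cancel_iff flip: ln_ge_iff)
      show "\<bar>exp (Y x b) - exp (Y y b)\<bar> \<le> \<rho> / 2"
        if x: "\<And>b. b \<in> B \<Longrightarrow> x b \<in> {0..\<eta>}" and y: "\<And>b. b \<in> B \<Longrightarrow> y b \<in> {0..\<eta>}"
          and \<rho>: "\<And>b. b \<in> B \<Longrightarrow> \<bar>x b - y b\<bar> \<le> \<rho>" and b: "b \<in> B" for x y \<rho> b
      proof -
        have \<rho>0: "\<rho> \<ge> 0" using \<rho>[OF b] by linarith
        have ln_diff: "\<bar>ln (u x a) - ln (u y a)\<bar> \<le> K * \<rho> / (w0 / 2)" if a: "a \<in> A" for a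
        proof -
          have "u x a - u y a = (\<Sum>b\<in>B. \<alpha> a b * (x b - y b))"
            by (simp add: u_def sum_subtractf right_diff_distrib)
          also have "\<bar>\<dots>\<bar> \<le> K * \<rho>" using \<rho> \<rho>0 K a by (intro abs_sum_mult_le) auto
          finally have "\<bar>u x a - u y a\<bar> / (w0 / 2) \<le> K * \<rho> / (w0 / 2)"
            using w0 by (intro divide_right_mono) auto
          moreover have "\<bar>ln (u x a) - ln (u y a)\<bar> \<le> \<bar>u x a - u y a\<bar> / (w0 / 2)"
            using w0(1) u_bounds[of x a] u_bounds[of y a] x y a by (intro abs_ln_diff_le) auto
          ultimately show ?thesis by linarith
        qed
        have "\<bar>Y x b - Y y b\<bar> = \<bar>\<Sum>a\<in>A. \<beta> b a * (ln (u x a) - ln (u y a))\<bar>"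
          by (simp add: Y_def sum_subtractf right_diff_distrib)
        also have "\<dots> \<le> K * (K * \<rho> / (w0 / 2))"
          using ln_diff K b \<rho>0 w0 by (intro abs_sum_mult_le) auto
        finally have Y_diff: "\<bar>Y x b - Y y b\<bar> \<le> K * (K * \<rho> / (w0 / 2))" .
        have "\<bar>exp (Y x b) - exp (Y y b)\<bar> \<le> exp (ln \<eta>) * \<bar>Y x b - Y y b\<bar>"
          using x y b by (intro abs_exp_diff_le Y_le) auto
        also have "\<dots> \<le> \<eta> * (K * (K * \<rho> / (w0 / 2)))"
          unfolding exp_ln[OF \<eta>] using \<eta> Y_diff by (intro mult_left_mono) auto
        finally show ?thesis unfolding half .
      qed
    qed (use \<eta> in auto)
    have \<delta>_pos: "\<delta> b > 0" if "b \<in> B" for b using \<delta>(2)[OF that] by (metis exp_gt_zero)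
    define P where "P = nodal_poly s B + interpolant s B \<delta>"
    define Q where "Q = Polynomial.smult (- L) (nodal_poly t A) + interpolant t A (\<lambda>a. ln (u \<delta> a))"
    have P_A: "poly P (s a) = u \<delta> a" for a
      by (simp add: P_def u_def w_def \<alpha>_def poly_nodal_poly poly_interpolant mult_ac)
    have P_B: "poly P (s b) = \<delta> b" if "b \<in> B" for b
      using that fin inj by (auto simp: P_def poly_nodal_poly poly_interpolant_node prod_zero_iff)
    have Q_A: "poly Q (t a) = ln (u \<delta> a)" if "a \<in> A" for a
      using that fin inj by (auto simp: Q_def poly_nodal_poly poly_interpolant_node prod_zero_iff)
    have Q_B: "poly Q (t b) = Y \<delta> b" for b
      by (simp add: Q_def Y_def w'_def \<beta>_def poly_nodal_poly poly_interpolant mult_ac)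
    have P_pos: "poly P (s a) \<ge> w0 / 2" if "a \<in> A" for a
      using u_bounds(1)[of \<delta> a] \<delta>(1) that by (simp add: P_A)
    have degP: "degree P \<le> k"
      unfolding P_def using degree_nodal_poly[of s B] card fin
      by (intro degree_le) (auto simp: coeff_interpolant coeff_eq_0)
    have cP: "poly.coeff P k = 1"
      using coeff_nodal_poly[of s B] fin card by (simp add: P_def coeff_interpolant)
    have degQ: "degree Q \<le> Suc d"
      unfolding Q_def using degree_nodal_poly[of t A] card fin
      by (intro degree_le) (auto simp: coeff_interpolant coeff_eq_0)
    have cQ: "poly.coeff Q (Suc d) = - L"
      using coeff_nodal_poly[of t A] fin card by (simp add: Q_def coeff_interpolant)
    have "poly P (s p) = exp (poly Q (t p))" if "p \<in> A \<union> B" for p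
      using that
    proof
      assume p: "p \<in> A"
      hence "u \<delta> p > 0" using P_pos[OF p] w0(1) by (simp add: P_A)
      with p show ?thesis by (simp add: P_A Q_A)
    next
      assume "p \<in> B"
      thus ?thesis using \<delta>(2)[of p] by (simp add: P_B Q_B)
    qed
    moreover have "poly P (s b) < poly P (s a)" if "a \<in> A" "b \<in> B" for a b
      using P_pos[OF that(1)] P_B[OF that(2)] \<delta>(1)[OF that(2)] \<eta>w0 w0(1) by auto
    moreover have "degree V = 0"
      if V: "degree V \<le> d" and R: "degree R \<le> k"
        and VR: "\<forall>p\<in>A \<union> B. poly V (t p) * poly P (s p) = poly R (s p)" for V R
    proof -
      \<comment> \<open>Subtracting \<open>c\<close> times the trivial variation
        \<open>(1, P)\<close> removes the coefficient of degree \<open>k\<close> from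
        \<open>R\<close>, since that of \<open>P\<close> is \<open>1\<close>. Then \<open>V'\<close>
        is determined by its values on \<open>A\<close> and \<open>R'\<close> by those on
        \<open>B\<close>, and the contraction estimate for the linear system bounds the largest
        value of \<open>R'\<close> on \<open>B\<close> by half of itself.\<close>
      define c where "c = poly.coeff R k"
      define V' where "V' = V - [:c:]"
      define R' where "R' = R - Polynomial.smult c P"
      have cV': "poly.coeff V' m = 0" if "m \<ge> card A" for m
        using that V card by (auto simp: V'_def coeff_pCons coeff_eq_0 split: nat.split)
      have cR': "poly.coeff R' m = 0" if "m \<ge> card B" for m
        using that R card degP cP by (cases "m = k") (auto simp: R'_def c_def coeff_eq_0)
      have VR': "poly V' (t p) * poly P (s p) = poly R' (s p)" if "p \<in> A \<union> B" for p
        using VR that by (auto simp: V'_def R'_def algebra_simps)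
      have V'_B: "poly V' (t b) = (\<Sum>a\<in>A. \<beta> b a * poly V' (t a))" for b
        unfolding \<beta>_def by (subst poly_eq_interpolation[OF fin(1) inj(2) cV']) (auto simp: mult_ac)
      have R'_A: "poly R' (s a) = (\<Sum>b\<in>B. \<alpha> a b * poly R' (s b))" for a
        unfolding \<alpha>_def by (subst poly_eq_interpolation[OF fin(2) inj(1) cR']) (auto simp: mult_ac)
      have V'_A: "\<bar>poly V' (t a)\<bar> \<le> K * \<rho> / (w0 / 2)"
        if a: "a \<in> A" and \<rho>: "\<And>b. b \<in> B \<Longrightarrow> \<bar>poly R' (s b)\<bar> \<le> \<rho>" and \<rho>0: "\<rho> \<ge> 0" for a \<rho>
      proof -
        have "\<bar>poly V' (t a)\<bar> * (w0 / 2) \<le> \<bar>poly V' (t a)\<bar> * poly P (s a)"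
          using P_pos[OF a] by (intro mult_left_mono) auto
        also have "\<dots> = \<bar>poly R' (s a)\<bar>"
          using arg_cong[OF VR'[of a], of abs] a P_pos[OF a] w0(1) by (simp add: abs_mult)
        also have "\<dots> \<le> K * \<rho>" 
          using a \<rho> \<rho>0 K by (subst R'_A, intro abs_sum_mult_le) auto
        finally show ?thesis using w0(1) by (simp add: pos_le_divide_eq)
      qed
      have R'_B: "poly R' (s b) = 0" if "b \<in> B" for b
      proof -
        define \<rho> where "\<rho> = Max ((\<lambda>b. \<bar>poly R' (s b)\<bar>) ` B)"
        have \<rho>: "\<bar>poly R' (s b)\<bar> \<le> \<rho>" if "b \<in> B" for b
          unfolding \<rho>_def using that fin by (intro Max_ge) auto
        have \<rho>0: "\<rho> \<ge> 0" using \<rho>[OF \<open>b \<in> B\<close>] by linarith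
        have "\<rho> \<in> (\<lambda>b. \<bar>poly R' (s b)\<bar>) ` B"
          unfolding \<rho>_def using fin \<open>b \<in> B\<close> by (intro Max_in) auto
        then obtain b0 where b0: "b0 \<in> B" "\<rho> = \<bar>poly R' (s b0)\<bar>" by auto
        have \<rho>_eq: "\<rho> = \<delta> b0 * \<bar>poly V' (t b0)\<bar>"
          unfolding b0(2) using arg_cong[OF VR'[of b0], of abs] b0(1) \<delta>_pos[OF b0(1)]
          by (simp add: abs_mult P_B mult.commute)
        have "\<bar>poly V' (t b0)\<bar> \<le> K * (K * \<rho> / (w0 / 2))"
        proof (subst V'_B, rule abs_sum_mult_le)
          show "\<bar>poly V' (t a)\<bar> \<le> K * \<rho> / (w0 / 2)" if "a \<in> A" for a
            using V'_A[OF that \<rho> \<rho>0] .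
          show "(\<Sum>a\<in>A. \<bar>\<beta> b0 a\<bar>) \<le> K" by (rule K(3)[OF b0(1)])
          show "0 \<le> K * \<rho> / (w0 / 2)" using K(1) \<rho>0 w0(1) by simp
        qed
        hence "\<delta> b0 * \<bar>poly V' (t b0)\<bar> \<le> \<eta> * (K * (K * \<rho> / (w0 / 2)))"
          using \<delta>(1)[OF b0(1)] \<eta> by (intro mult_mono) auto
        hence "\<rho> \<le> 0" unfolding half \<rho>_eq[symmetric] by linarith
        with \<rho>[OF \<open>b \<in> B\<close>] show ?thesis by simp
      qed
      have "poly V' (t a) = 0" if "a \<in> A" for a using V'_A[OF that, of 0] R'_B by simp
      hence "poly V' x = 0" for x
        by (subst poly_eq_interpolation[OF fin(1) inj(2) cV']) auto
      hence "V' = 0" using poly_all_0_iff_0 by blast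
      thus ?thesis by (simp add: V'_def)
    qed
    ultimately show "\<exists>P Q. degree P \<le> k \<and> degree Q \<le> Suc d \<and> poly.coeff Q (Suc d) = - L \<and>
      (\<forall>p\<in>A \<union> B. poly P (s p) = exp (poly Q (t p))) \<and>
      (\<forall>a\<in>A. \<forall>b\<in>B. poly P (s b) < poly P (s a)) \<and>
      (\<forall>V R. degree V \<le> d \<longrightarrow> degree R \<le> k \<longrightarrow>
         (\<forall>p\<in>A \<union> B. poly V (t p) * poly P (s p) = poly R (s p)) \<longrightarrow> degree V = 0)"
      using degP degQ cQ by (intro exI[of _ P] exI[of _ Q]) blast
  qed
qed

subsection \<open>Systems of Laurent polynomials\<close>

lemma invertible_mat_iff_kernel:
  fixes M :: "real Matrix.mat"
  assumes M: "M \<in> carrier_mat n n"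
  shows "invertible_mat M \<longleftrightarrow> (\<forall>v. (\<forall>i<n. (\<Sum>j<n. M $$ (i, j) * v j) = 0) \<longrightarrow> (\<forall>j<n. v j = 0))"
proof -
  have inv: "invertible_mat M \<longleftrightarrow> Determinant.det M \<noteq> 0"
  proof
    assume "invertible_mat M"
    then obtain B where B: "inverts_mat M B" "inverts_mat B M"
      unfolding invertible_mat_def by blast
    have MB: "M * B = 1\<^sub>m n" using B(1) M unfolding inverts_mat_def by auto
    have BM: "B * M = 1\<^sub>m (dim_row B)" using B(2) unfolding inverts_mat_def by auto
    \<comment> \<open>\<open>inverts_mat\<close> does not fix the size of the inverse; it is read
      off from the two products.\<close>
    have "dim_col B = n" using arg_cong[OF MB, of dim_col] by simp
    moreover have "dim_row B = n" using arg_cong[OF BM, of dim_col] M by simp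
    ultimately have "B \<in> carrier_mat n n" by auto
    from det_mult[OF M this] MB show "Determinant.det M \<noteq> 0"
      by auto
  next
    assume "Determinant.det M \<noteq> 0"
    from det_non_zero_imp_unit[OF M this, of "()"]
    obtain B where "B \<in> carrier_mat n n" "B * M = 1\<^sub>m n" "M * B = 1\<^sub>m n"
      unfolding Units_def ring_mat_def by auto
    with M show "invertible_mat M"
      unfolding invertible_mat_def inverts_mat_def by auto
  qed
  have mult: "M *\<^sub>v Matrix.vec n v = 0\<^sub>v n \<longleftrightarrow> (\<forall>i<n. (\<Sum>j<n. M $$ (i, j) * v j) = 0)" for v
    using M by (auto simp: Matrix.vec_eq_iff scalar_prod_def lessThan_atLeast0)
  show ?thesis
    unfolding inv det_0_iff_vec_prod_zero[OF M]
  proof safe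
    fix v j assume nex: "\<nexists>v. v \<in> carrier_vec n \<and> v \<noteq> 0\<^sub>v n \<and> M *\<^sub>v v = 0\<^sub>v n"
      and "\<forall>i<n. (\<Sum>j<n. M $$ (i, j) * v j) = 0" and j: "j < n"
    hence "M *\<^sub>v Matrix.vec n v = 0\<^sub>v n" using mult by blast
    hence "Matrix.vec n v = 0\<^sub>v n" using nex vec_carrier[of n v] by blast
    from arg_cong[OF this, of "\<lambda>w. vec_index w j"] j show "v j = 0" by simp
  next
    fix w assume triv: "\<forall>v. (\<forall>i<n. (\<Sum>j<n. M $$ (i, j) * v j) = 0) \<longrightarrow> (\<forall>j<n. v j = 0)"
      and w: "w \<in> carrier_vec n" "w \<noteq> 0\<^sub>v n" "M *\<^sub>v w = 0\<^sub>v n"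
    have "w = Matrix.vec n (vec_index w)" using w(1) by auto
    with w(3) mult[of "vec_index w"] triv have "\<forall>j<n. vec_index w j = 0" by metis
    with w(1,2) show False by (metis carrier_vecD eq_vecI index_zero_vec(1,2))
  qed
qed

lemma poly_eval_eq_sum:
  assumes S: "finite S" "Poly_Mapping.keys p \<subseteq> S" and p: "p \<in> polys_in d"
  shows "poly_eval p x =
    (\<Sum>m\<in>S. Poly_Mapping.lookup p m * (\<Prod>i<d. x i ^ Poly_Mapping.lookup m i))"
proof -
  have "poly_eval p x =
    (\<Sum>m\<in>Poly_Mapping.keys p. Poly_Mapping.lookup p m * (\<Prod>i<d. x i ^ Poly_Mapping.lookup m i))"
    unfolding poly_eval_def
  proof (intro sum.cong refl arg_cong2[where f = "(*)"] prod.mono_neutral_left)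
    fix m assume "m \<in> Poly_Mapping.keys p"
    with p show "Poly_Mapping.keys m \<subseteq> {..<d}" by (auto simp: polys_in_def)
  qed (auto simp: in_keys_iff)
  also have "\<dots> = (\<Sum>m\<in>S. Poly_Mapping.lookup p m * (\<Prod>i<d. x i ^ Poly_Mapping.lookup m i))"
    using S by (intro sum.mono_neutral_left) (auto simp: in_keys_iff)
  finally show ?thesis .
qed

text \<open>In logarithmic form: \<open>x j\<close> times the partial derivative multiplies each
  monomial by its exponent at \<open>j\<close>.\<close>

lemma deriv_poly_eval:
  assumes S: "finite S" "Poly_Mapping.keys p \<subseteq> S" and p: "p \<in> polys_in d"
    and j: "j < d" and x: "x j > 0"
  shows "deriv (\<lambda>t. poly_eval p (x(j := t))) (x j) =
    (\<Sum>m\<in>S. Poly_Mapping.lookup p m * (\<Prod>i<d. x i ^ Poly_Mapping.lookup m i) *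
      real (Poly_Mapping.lookup m j)) / x j"
proof -
  have split: "(\<Prod>i<d. y i ^ e i) = y j ^ e j * (\<Prod>i\<in>{..<d} - {j}. y i ^ e i)"
    for y :: "nat \<Rightarrow> real" and e :: "nat \<Rightarrow> nat"
    using j by (subst prod.remove[of _ j]) auto
  have upd: "(\<Prod>i\<in>{..<d} - {j}. (x(j := t)) i ^ e i) = (\<Prod>i\<in>{..<d} - {j}. x i ^ e i)"
    for t and e :: "nat \<Rightarrow> nat"
    by (intro prod.cong) auto
  have pow: "real e * x j ^ (e - Suc 0) = real e * x j ^ e / x j" for e
    using x by (cases e) auto
  have "((\<lambda>t. poly_eval p (x(j := t))) has_real_derivative
     (\<Sum>m\<in>S. Poly_Mapping.lookup p m * (real (Poly_Mapping.lookup m j) *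
        x j ^ (Poly_Mapping.lookup m j - Suc 0) *
        (\<Prod>i\<in>{..<d} - {j}. x i ^ Poly_Mapping.lookup m i)))) (at (x j))"
    unfolding poly_eval_eq_sum[OF S p] split upd fun_upd_same
    by (auto intro!: derivative_eq_intros sum.cong)
  also have "(\<Sum>m\<in>S. Poly_Mapping.lookup p m * (real (Poly_Mapping.lookup m j) *
        x j ^ (Poly_Mapping.lookup m j - Suc 0) *
        (\<Prod>i\<in>{..<d} - {j}. x i ^ Poly_Mapping.lookup m i))) =
     (\<Sum>m\<in>S. Poly_Mapping.lookup p m * (\<Prod>i<d. x i ^ Poly_Mapping.lookup m i) *
      real (Poly_Mapping.lookup m j)) / x j"
    unfolding sum_divide_distrib split pow by (intro sum.cong) (auto simp: mult_ac)
  finally show ?thesis by (rule DERIV_imp_deriv)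
qed

text \<open>At a positive point the substitution of \<open>v j / x j\<close> for \<open>v j\<close>
  is invertible and turns the kernel of the Jacobian into that of the logarithmic one.\<close>

lemma invertible_jacobian_iff:
  assumes S: "finite S" "\<And>i. i < d \<Longrightarrow> Poly_Mapping.keys (f i) \<subseteq> S"
    and f: "\<And>i. i < d \<Longrightarrow> f i \<in> polys_in d"
    and x: "\<And>i. i < d \<Longrightarrow> x i > 0"
  shows "invertible_mat (jacobian d f x) \<longleftrightarrow>
    (\<forall>v. (\<forall>i<d. (\<Sum>m\<in>S. Poly_Mapping.lookup (f i) m * (\<Prod>i<d. x i ^ Poly_Mapping.lookup m i) *
       (\<Sum>j<d. real (Poly_Mapping.lookup m j) * v j)) = 0) \<longrightarrow> (\<forall>j<d. v j = 0))"
    (is "_ \<longleftrightarrow> ?K")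
proof -
  let ?G = "\<lambda>i v. \<Sum>m\<in>S. Poly_Mapping.lookup (f i) m * (\<Prod>i<d. x i ^ Poly_Mapping.lookup m i) *
       (\<Sum>j<d. real (Poly_Mapping.lookup m j) * v j)"
  have J: "jacobian d f x \<in> carrier_mat d d" by (simp add: jacobian_def)
  have sum: "(\<Sum>j<d. jacobian d f x $$ (i, j) * v j) = ?G i (\<lambda>j. v j / x j)" if i: "i < d" for i v
  proof -
    have "(\<Sum>j<d. jacobian d f x $$ (i, j) * v j) = (\<Sum>j<d. (\<Sum>m\<in>S. Poly_Mapping.lookup (f i) m *
      (\<Prod>i<d. x i ^ Poly_Mapping.lookup m i) * real (Poly_Mapping.lookup m j)) / x j * v j)"
      using i S f x by (intro sum.cong) (simp_all add: jacobian_def deriv_poly_eval[where S = S and d = d])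
    also have "\<dots> = ?G i (\<lambda>j. v j / x j)"
      by (simp add: sum_distrib_left sum_distrib_right sum_divide_distrib mult_ac)
        (rule sum.swap)
    finally show ?thesis .
  qed
  show ?thesis
    unfolding invertible_mat_iff_kernel[OF J]
  proof (intro iffI allI impI)
    fix v j
    assume triv: "\<forall>v. (\<forall>i<d. (\<Sum>j<d. jacobian d f x $$ (i, j) * v j) = 0) \<longrightarrow> (\<forall>j<d. v j = 0)"
      and v: "\<forall>i<d. ?G i v = 0" and j: "j < d"
    have "?G i (\<lambda>j. (v j * x j) / x j) = ?G i v" for i
      by (intro sum.cong arg_cong2[where f = "(*)"] refl) (auto dest: x)
    hence "\<forall>i<d. (\<Sum>j<d. jacobian d f x $$ (i, j) * (v j * x j)) = 0"
      using v sum[of _ "\<lambda>j. v j * x j"] by simp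
    with spec[OF triv, of "\<lambda>j. v j * x j"] j have "v j * x j = 0" by blast
    with x[OF j] show "v j = 0" by simp
  next
    fix v j
    assume triv: ?K and v: "\<forall>i<d. (\<Sum>j<d. jacobian d f x $$ (i, j) * v j) = 0" and j: "j < d"
    have "\<forall>i<d. ?G i (\<lambda>j. v j / x j) = 0"
    proof (intro allI impI)
      fix i assume i: "i < d"
      show "?G i (\<lambda>j. v j / x j) = 0"
        using trans[OF sum[OF i, of v, symmetric] mp[OF spec[OF v, of i] i]] .
    qed
    with spec[OF triv, of "\<lambda>j. v j / x j"] j have "v j / x j = 0" by blast
    with x[OF j] show "v j = 0" by simp
  qed
qed

definition laurent_monomial :: "nat \<Rightarrow> (nat \<Rightarrow> nat \<Rightarrow> int) \<Rightarrow> nat \<Rightarrow> (nat \<Rightarrow> real) \<Rightarrow> real" where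
  "laurent_monomial d E p x = (\<Prod>m<d. x m powi E p m)"

text \<open>
  In logarithmic coordinates the Jacobian of \<open>\<Sum>p. C i p * x\<^bsup>E p\<^esup>\<close> acts by
  \<open>v \<mapsto> \<Sum>p. C i p * x\<^bsup>E p\<^esup> * (E p \<bullet> v)\<close>. At a solution this does not change if all
  exponents \<open>E p\<close> are translated by the same vector.
\<close>

definition laurent_solutions ::
    "nat \<Rightarrow> nat \<Rightarrow> (nat \<Rightarrow> nat \<Rightarrow> int) \<Rightarrow> (nat \<Rightarrow> nat \<Rightarrow> real) \<Rightarrow> (nat \<Rightarrow> real) set" where
  "laurent_solutions d n E C = {x \<in> {..<d} \<rightarrow>\<^sub>E {0<..}.
     (\<forall>i<d. (\<Sum>p<n. C i p * laurent_monomial d E p x) = 0) \<and>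
     (\<forall>v. (\<forall>i<d. (\<Sum>p<n. C i p * laurent_monomial d E p x * (\<Sum>m<d. real_of_int (E p m) * v m)) = 0)
        \<longrightarrow> (\<forall>m<d. v m = 0))}"

lemma laurent_monomial_translate:
  assumes "\<And>m. m < d \<Longrightarrow> x m > 0"
  shows "laurent_monomial d (\<lambda>p m. E p m + \<tau> m) p x = laurent_monomial d E p x * (\<Prod>m<d. x m powi \<tau> m)"
proof -
  have "x m powi (E p m + \<tau> m) = x m powi E p m * x m powi \<tau> m" if "m < d" for m
    using assms[OF that] by (simp add: power_int_add)
  thus ?thesis unfolding laurent_monomial_def by (simp flip: prod.distrib)
qed

lemma laurent_solutions_translate:
  "laurent_solutions d n E C \<subseteq> laurent_solutions d n (\<lambda>p m. E p m + \<tau> m) C"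
proof
  fix x assume x: "x \<in> laurent_solutions d n E C"
  hence pos: "m < d \<Longrightarrow> x m > 0" for m by (auto simp: laurent_solutions_def)
  define T where "T = (\<Prod>m<d. x m powi \<tau> m)"
  have T: "T > 0" unfolding T_def by (intro prod_pos) (auto intro: zero_less_power_int pos)
  have mono: "laurent_monomial d (\<lambda>p m. E p m + \<tau> m) p x = laurent_monomial d E p x * T" for p
    unfolding T_def by (rule laurent_monomial_translate) (rule pos)
  have eq: "(\<Sum>p<n. C i p * laurent_monomial d E p x) = 0" if "i < d" for i
    using x that by (auto simp: laurent_solutions_def)
  have lin: "(\<Sum>p<n. C i p * (laurent_monomial d E p x * T) * (\<Sum>m<d. real_of_int (E p m + \<tau> m) * v m))
     = T * (\<Sum>p<n. C i p * laurent_monomial d E p x * (\<Sum>m<d. real_of_int (E p m) * v m))"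
    (is "?l = ?r") if "i < d" for i v
  proof -
    \<comment> \<open>The translation adds the same number \<open>b\<close> to every inner product,
      which contributes a multiple of equation \<open>i\<close> and hence zero.\<close>
    define b where "b = (\<Sum>m<d. real_of_int (\<tau> m) * v m)"
    have "(\<Sum>m<d. real_of_int (E p m + \<tau> m) * v m) = (\<Sum>m<d. real_of_int (E p m) * v m) + b" for p
      by (simp add: b_def sum.distrib distrib_right)
    hence "?l = (\<Sum>p<n. T * (C i p * laurent_monomial d E p x * (\<Sum>m<d. real_of_int (E p m) * v m)) +
        T * b * (C i p * laurent_monomial d E p x))"
      by (intro sum.cong refl) (simp only:, simp add: distrib_left)
    also have "\<dots> = ?r + T * b * (\<Sum>p<n. C i p * laurent_monomial d E p x)"
      by (simp only: sum.distrib sum_distrib_left)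
    finally have "?l = ?r + T * b * (\<Sum>p<n. C i p * laurent_monomial d E p x)" .
    with eq[OF that] show ?thesis by simp
  qed
  have eq': "(\<Sum>p<n. C i p * (laurent_monomial d E p x * T)) = 0" if "i < d" for i
    using eq[OF that] by (simp flip: mult.assoc sum_distrib_right)
  show "x \<in> laurent_solutions d n (\<lambda>p m. E p m + \<tau> m) C"
    unfolding laurent_solutions_def mem_Collect_eq mono
  proof (intro conjI allI impI)
    show "x \<in> {..<d} \<rightarrow>\<^sub>E {0<..}" using x by (simp add: laurent_solutions_def)
    show "i < d \<Longrightarrow> (\<Sum>p<n. C i p * (laurent_monomial d E p x * T)) = 0" for i by (rule eq')
    fix v m
    assume v: "\<forall>i<d. (\<Sum>p<n. C i p * (laurent_monomial d E p x * T) *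
      (\<Sum>m<d. real_of_int (E p m + \<tau> m) * v m)) = 0" and m: "m < d"
    have "(\<Sum>p<n. C i p * laurent_monomial d E p x * (\<Sum>m<d. real_of_int (E p m) * v m)) = 0"
      if "i < d" for i using v T lin[OF that, of v] that by simp
    thus "v m = 0" using x m unfolding laurent_solutions_def by blast
  qed
qed

lemma nondeg_pos_solutions_eq_laurent:
  assumes f: "f \<in> sparse_systems d k"
  obtains E C where "nondeg_pos_solutions d f = laurent_solutions d (d + k + 1) E C"
proof -
  define S where "S = (\<Union>i<d. Poly_Mapping.keys (f i))"
  have finS: "finite S" by (auto simp: S_def)
  have cS: "card S \<le> d + k + 1" using f by (simp add: sparse_systems_def S_def)
  obtain e where e: "bij_betw e {..<card S} S"
    using ex_bij_betw_nat_finite[OF finS] by (auto simp: lessThan_atLeast0)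
  define E where "E = (\<lambda>p m. int (Poly_Mapping.lookup (e p) m))"
  \<comment> \<open>If fewer than \<open>d + k + 1\<close> monomials occur, the surplus indices get
    coefficient \<open>0\<close>.\<close>
  define C where "C = (\<lambda>i p. if p < card S then Poly_Mapping.lookup (f i) (e p) else 0)"
  have sum: "(\<Sum>m\<in>S. Poly_Mapping.lookup (f i) m * h m) = (\<Sum>p<d + k + 1. C i p * h (e p))" for i h
  proof -
    have "(\<Sum>m\<in>S. Poly_Mapping.lookup (f i) m * h m) = (\<Sum>p<card S. C i p * h (e p))"
      by (subst sum.reindex_bij_betw[OF e, symmetric]) (simp add: C_def)
    also have "\<dots> = (\<Sum>p<d + k + 1. C i p * h (e p))"
      using cS by (intro sum.mono_neutral_left) (auto simp: C_def)
    finally show ?thesis .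
  qed
  have fin: "f i \<in> polys_in d" if "i < d" for i using f that by (auto simp: sparse_systems_def)
  have keys: "Poly_Mapping.keys (f i) \<subseteq> S" if "i < d" for i using that by (auto simp: S_def)
  have mono: "(\<Prod>i<d. x i ^ Poly_Mapping.lookup (e p) i) = laurent_monomial d E p x" for p x
    by (simp add: laurent_monomial_def E_def)
  have eval: "poly_eval (f i) x = (\<Sum>p<d + k + 1. C i p * laurent_monomial d E p x)" if "i < d" for i x
    unfolding poly_eval_eq_sum[OF finS keys[OF that] fin[OF that]] sum mono ..
  have jac: "invertible_mat (jacobian d f x) \<longleftrightarrow>
      (\<forall>v. (\<forall>i<d. (\<Sum>p<d + k + 1. C i p * laurent_monomial d E p x * (\<Sum>m<d. real_of_int (E p m) * v m)) = 0)
        \<longrightarrow> (\<forall>m<d. v m = 0))" if "x \<in> {..<d} \<rightarrow>\<^sub>E {0<..}" for x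
    using that
    by (subst invertible_jacobian_iff[OF finS keys fin])
      (auto simp: mult.assoc sum mono E_def simp del: sum.lessThan_Suc)
  have "nondeg_pos_solutions d f = laurent_solutions d (d + k + 1) E C"
    unfolding nondeg_pos_solutions_def laurent_solutions_def
    by (intro Collect_cong conj_cong refl jac) (auto simp: eval simp del: sum.lessThan_Suc)
  with that show ?thesis by blast
qed

text \<open>A common translation makes all exponents nonnegative without losing a solution. Indices
  with equal exponents have their coefficients added, which can only reduce the number of
  monomials.\<close>

lemma laurent_subset_nondeg_pos_solutions:
  assumes n: "n \<le> d + k + 1"
  obtains f where "f \<in> sparse_systems d k" "laurent_solutions d n E C \<subseteq> nondeg_pos_solutions d f"
proof -
  define \<tau> where "\<tau> = (\<lambda>m. \<Sum>p<n. \<bar>E p m\<bar>)"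
  have nonneg: "E p m + \<tau> m \<ge> 0" if "p < n" for p m
  proof -
    have "\<bar>E p m\<bar> \<le> \<tau> m" unfolding \<tau>_def using that by (intro member_le_sum) auto
    thus ?thesis by linarith
  qed
  define e where "e = (\<lambda>p. \<Sum>m<d. Poly_Mapping.single m (nat (E p m + \<tau> m)))"
  have lookup_e: "Poly_Mapping.lookup (e p) m = (if m < d then nat (E p m + \<tau> m) else 0)" for p m
    by (auto simp: e_def lookup_sum lookup_single when_def)
  define f where "f = (\<lambda>i. \<Sum>p<n. Poly_Mapping.single (e p) (C i p))"
  define S where "S = e ` {..<n}"
  have finS: "finite S" by (simp add: S_def)
  have lookup_f: "Poly_Mapping.lookup (f i) m = (\<Sum>p | p < n \<and> e p = m. C i p)" for i m
    by (simp add: f_def lookup_sum lookup_single when_def sum.If_cases Int_def)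
  have keys: "Poly_Mapping.keys (f i) \<subseteq> S" for i
  proof
    fix m assume "m \<in> Poly_Mapping.keys (f i)"
    hence "(\<Sum>p | p < n \<and> e p = m. C i p) \<noteq> 0" by (simp add: in_keys_iff lookup_f)
    then obtain p where "p < n" "e p = m" by (auto elim!: sum.not_neutral_contains_not_neutral)
    thus "m \<in> S" by (auto simp: S_def)
  qed
  have "Poly_Mapping.keys (e p) \<subseteq> {..<d}" for p
    by (auto simp: in_keys_iff lookup_e split: if_splits)
  hence fin: "f i \<in> polys_in d" for i using keys[of i] by (fastforce simp: polys_in_def S_def)
  have "card (\<Union>i<d. Poly_Mapping.keys (f i)) \<le> card S"
    using keys finS by (intro card_mono) auto
  also have "\<dots> \<le> n" unfolding S_def using card_image_le[of "{..<n}" e] by simp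
  finally have sp: "f \<in> sparse_systems d k" using n fin by (auto simp: sparse_systems_def)
  have sum: "(\<Sum>m\<in>S. Poly_Mapping.lookup (f i) m * h m) = (\<Sum>p<n. C i p * h (e p))" for i h
  proof -
    have "(\<Sum>m\<in>S. Poly_Mapping.lookup (f i) m * h m) =
        (\<Sum>m\<in>S. \<Sum>p | p \<in> {..<n} \<and> e p = m. C i p * h (e p))"
      by (intro sum.cong refl) (auto simp: lookup_f sum_distrib_right)
    also have "\<dots> = (\<Sum>p<n. C i p * h (e p))"
      by (rule sum.group) (auto simp: finS S_def)
    finally show ?thesis .
  qed
  let ?E = "\<lambda>p m. E p m + \<tau> m"
  have mono: "(\<Prod>i<d. x i ^ Poly_Mapping.lookup (e p) i) = laurent_monomial d ?E p x" if "p < n" for p x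
    unfolding laurent_monomial_def
    using nonneg[OF that] by (intro prod.cong refl) (simp add: lookup_e power_int_def)
  have lk: "(\<Sum>m<d. real (Poly_Mapping.lookup (e p) m) * v m) = (\<Sum>m<d. real_of_int (?E p m) * v m)"
    if "p < n" for p v
    using nonneg[OF that] by (intro sum.cong refl) (simp add: lookup_e)
  have eval: "poly_eval (f i) x = (\<Sum>p<n. C i p * laurent_monomial d ?E p x)" for i x
    unfolding poly_eval_eq_sum[OF finS keys fin] sum by (simp add: mono)
  have jac: "invertible_mat (jacobian d f x) \<longleftrightarrow>
      (\<forall>v. (\<forall>i<d. (\<Sum>p<n. C i p * laurent_monomial d ?E p x * (\<Sum>m<d. real_of_int (?E p m) * v m)) = 0)
        \<longrightarrow> (\<forall>m<d. v m = 0))" if "x \<in> {..<d} \<rightarrow>\<^sub>E {0<..}" for x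
    using that
    by (subst invertible_jacobian_iff[OF finS keys fin])
      (auto simp: mult.assoc sum mono lk simp del: of_int_add)
  have "laurent_solutions d n ?E C \<subseteq> nondeg_pos_solutions d f"
    unfolding nondeg_pos_solutions_def laurent_solutions_def
    by (intro Collect_mono impI) (auto simp: eval jac simp del: of_int_add)
  with laurent_solutions_translate[of d n E C \<tau>] sp that show ?thesis by blast
qed

section \<open>Realizable numbers of solutions and products of systems\<close>

definition realizable :: "nat \<Rightarrow> nat \<Rightarrow> nat \<Rightarrow> bool" where
  "realizable d k N \<longleftrightarrow> (\<exists>E C X. X \<subseteq> laurent_solutions d (d + k + 1) E C \<and> finite X \<and> card X = N)"

lemma enat_le_ecard_iff: "enat N \<le> ecard A \<longleftrightarrow> (\<exists>X\<subseteq>A. finite X \<and> card X = N)"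
proof (cases "finite A")
  case True
  thus ?thesis
    by (auto simp: ecard_def intro: card_mono) (meson obtain_subset_with_card_n)
next
  case False
  thus ?thesis using infinite_arbitrarily_large[OF False, of N] by (auto simp: ecard_def)
qed

text \<open>Lower bounds for \<open>Xi\<close> are expressed by finite sets of solutions, which
  covers infinite values as well. For \<open>N = Suc M\<close> some system exceeds \<open>M\<close>,
  whether or not the supremum is attained.\<close>

lemma realizable_iff: "realizable d k N \<longleftrightarrow> enat N \<le> Xi d k"
proof
  assume "realizable d k N"
  then obtain E C X where X: "X \<subseteq> laurent_solutions d (d + k + 1) E C" "finite X" "card X = N"
    unfolding realizable_def by blast
  obtain f where f: "f \<in> sparse_systems d k"
    "laurent_solutions d (d + k + 1) E C \<subseteq> nondeg_pos_solutions d f"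
    using laurent_subset_nondeg_pos_solutions[of "d + k + 1" d k E C] by blast
  have "enat N \<le> ecard (nondeg_pos_solutions d f)"
    using X f(2) enat_le_ecard_iff by blast
  also have "\<dots> \<le> Xi d k" unfolding Xi_def using f(1) by (rule SUP_upper)
  finally show "enat N \<le> Xi d k" .
next
  assume le: "enat N \<le> Xi d k"
  have "\<exists>f\<in>sparse_systems d k. enat N \<le> ecard (nondeg_pos_solutions d f)"
  proof (cases N)
    case 0
    have "(\<lambda>i. 0) \<in> sparse_systems d k" by (simp add: sparse_systems_def polys_in_def)
    with 0 show ?thesis by (auto simp flip: zero_enat_def)
  next
    case (Suc M)
    hence "enat M < Xi d k" using le by (meson Suc_ile_eq)
    then obtain f where "f \<in> sparse_systems d k" "enat M < ecard (nondeg_pos_solutions d f)"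
      unfolding Xi_def by (auto simp: less_SUP_iff)
    with Suc show ?thesis by (auto simp: Suc_ile_eq)
  qed
  then obtain f where f: "f \<in> sparse_systems d k" "enat N \<le> ecard (nondeg_pos_solutions d f)" by blast
  from nondeg_pos_solutions_eq_laurent[OF f(1)] f(2) show "realizable d k N"
    unfolding realizable_def enat_le_ecard_iff by metis
qed

lemma sum_lessThan_add: "(\<Sum>p<a + b. f p) = (\<Sum>p<a. f p) + (\<Sum>p<b. f (a + p))"
  for f :: "nat \<Rightarrow> 'a::comm_monoid_add"
  by (induction b) (simp_all add: add.assoc)

lemma prod_lessThan_add: "(\<Prod>p<a + b. f p) = (\<Prod>p<a. f p) * (\<Prod>p<b. f (a + p))"
  for f :: "nat \<Rightarrow> 'a::comm_monoid_mult"
  by (induction b) (simp_all add: mult.assoc)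

text \<open>With a constant monomial at index \<open>0\<close>, two systems in separate variables
  can share it, which saves one monomial in their product.\<close>

lemma realizable_normalizedE:
  assumes "realizable d k N"
  obtains E C X where "X \<subseteq> laurent_solutions d (d + k + 1) E C" "finite X" "card X = N" "\<And>m. E 0 m = 0"
proof -
  obtain E C X where X: "X \<subseteq> laurent_solutions d (d + k + 1) E C" "finite X" "card X = N"
    using assms unfolding realizable_def by blast
  show ?thesis
  proof (rule that[of X "\<lambda>p m. E p m + - E 0 m" C])
    show "X \<subseteq> laurent_solutions d (d + k + 1) (\<lambda>p m. E p m + - E 0 m) C"
      using X(1) laurent_solutions_translate[of d "d + k + 1" E C "\<lambda>m. - E 0 m"] by blast
  qed (use X in auto)
qed

text \<open>The two systems have disjoint sets of variables and share the constant monomial.\<close>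

lemma realizable_mult:
  assumes 1: "realizable d k N" and 2: "realizable d' k' N'"
  shows "realizable (d + d') (k + k') (N * N')"
proof -
  define n where "n = d + k + 1"
  obtain E C X where X: "X \<subseteq> laurent_solutions d n E C" "finite X" "card X = N"
    and E0: "\<And>m. E 0 m = 0"
    using realizable_normalizedE[OF 1] unfolding n_def by metis
  obtain E' C' X' where X': "X' \<subseteq> laurent_solutions d' (Suc (d' + k')) E' C'" "finite X'" "card X' = N'"
    and E'0: "\<And>m. E' 0 m = 0"
    using realizable_normalizedE[OF 2] unfolding Suc_eq_plus1 by metis
  \<comment> \<open>Indices below \<open>n\<close> carry the first system. Index
    \<open>n + q\<close> carries monomial \<open>Suc q\<close> of the second, whose monomial
    \<open>0\<close> is identified with index \<open>0\<close>.\<close>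
  define F where "F = (\<lambda>p m. if p < n then (if m < d then E p m else 0)
     else (if m < d then 0 else E' (Suc (p - n)) (m - d)))"
  define G where "G = (\<lambda>i p. if i < d then (if p < n then C i p else 0)
     else if p = 0 then C' (i - d) 0 else if p < n then 0 else C' (i - d) (Suc (p - n)))"
  define glue where "glue = (\<lambda>x y m. if m < d then x m else y (m - d) :: real)"
  have n0: "n > 0" by (simp add: n_def)
  have mono: "laurent_monomial (d + d') F p (glue x y) = laurent_monomial d E p x" if "p < n" for p x y
    using that by (simp add: laurent_monomial_def prod_lessThan_add F_def glue_def)
  have mono': "laurent_monomial (d + d') F (n + q) (glue x y) = laurent_monomial d' E' (Suc q) y" for q x y
    by (simp add: laurent_monomial_def prod_lessThan_add F_def glue_def)
  have lin: "(\<Sum>m<d + d'. real_of_int (F p m) * v m) = (\<Sum>m<d. real_of_int (E p m) * v m)"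
    if "p < n" for p v
    using that by (simp add: sum_lessThan_add F_def)
  have lin': "(\<Sum>m<d + d'. real_of_int (F (n + q) m) * v m) =
      (\<Sum>m<d'. real_of_int (E' (Suc q) m) * v (d + m))" for q v
    by (simp add: sum_lessThan_add F_def)
  have G: "(\<Sum>p<n + (d' + k'). G i p * h p) = (\<Sum>p<n. C i p * h p)" if "i < d" for i h
    using that by (simp add: sum_lessThan_add G_def)
  have G': "(\<Sum>p<n + (d' + k'). G (d + i) p * h p) = (\<Sum>p<Suc (d' + k'). C' i p * h' p)"
    if "h' 0 = h 0" "\<And>q. h' (Suc q) = h (n + q)" for i h h'
  proof -
    have "(\<Sum>p<n. G (d + i) p * h p) = (\<Sum>p<n. if p = 0 then C' i 0 * h 0 else 0)"
      by (intro sum.cong) (auto simp: G_def)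
    also have "\<dots> = C' i 0 * h 0" using n0 by (subst sum.delta) auto
    finally show ?thesis
      using n0 that by (simp add: sum_lessThan_add sum.lessThan_Suc_shift G_def del: sum.lessThan_Suc)
  qed
  have sol: "glue x y \<in> laurent_solutions (d + d') (n + (d' + k')) F G" if x: "x \<in> X" and y: "y \<in> X'" for x y
    unfolding laurent_solutions_def mem_Collect_eq
  proof (intro conjI allI impI)
    have x': "x \<in> laurent_solutions d n E C" and y': "y \<in> laurent_solutions d' (Suc (d' + k')) E' C'"
      using x y X X' by auto
    show "glue x y \<in> {..<d + d'} \<rightarrow>\<^sub>E {0<..}"
      using x' y' by (auto simp: laurent_solutions_def glue_def PiE_def extensional_def Pi_def)
    have one: "laurent_monomial d' E' 0 y = 1" "laurent_monomial (d + d') F 0 (glue x y) = 1"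
      using n0 E0 E'0 by (simp_all add: mono) (simp_all add: laurent_monomial_def)
    show "(\<Sum>p<n + (d' + k'). G i p * laurent_monomial (d + d') F p (glue x y)) = 0" if "i < d + d'" for i
    proof (cases "i < d")
      case True
      thus ?thesis using x' by (simp add: G mono laurent_solutions_def)
    next
      case False
      define i' where "i' = i - d"
      have i: "i = d + i'" "i' < d'" using False that by (auto simp: i'_def)
      show ?thesis
        using y' i(2) unfolding i(1)
        by (subst G'[where h' = "\<lambda>p. laurent_monomial d' E' p y"])
          (auto simp: one mono' laurent_solutions_def simp del: sum.lessThan_Suc)
    qed
    fix v m
    assume v: "\<forall>i<d + d'. (\<Sum>p<n + (d' + k'). G i p * laurent_monomial (d + d') F p (glue x y) *
        (\<Sum>m<d + d'. real_of_int (F p m) * v m)) = 0" and m: "m < d + d'"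
    have v1: "(\<Sum>p<n. C i p * laurent_monomial d E p x * (\<Sum>m<d. real_of_int (E p m) * v m)) = 0"
      if "i < d" for i
    proof -
      have "(\<Sum>p<n. C i p * (laurent_monomial (d + d') F p (glue x y) *
          (\<Sum>m<d + d'. real_of_int (F p m) * v m))) = 0"
        using v that by (subst G[symmetric]) (simp_all add: mult.assoc)
      thus ?thesis by (simp add: mono lin mult.assoc)
    qed
    have v2: "(\<Sum>p<Suc (d' + k'). C' i p * laurent_monomial d' E' p y *
        (\<Sum>m<d'. real_of_int (E' p m) * v (d + m))) = 0" if "i < d'" for i
    proof -
      have "(\<Sum>p<n + (d' + k'). G (d + i) p * (laurent_monomial (d + d') F p (glue x y) *
          (\<Sum>m<d + d'. real_of_int (F p m) * v m))) = 0"
        using v that by (simp add: mult.assoc)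
      thus ?thesis
        unfolding mult.assoc
        by (subst (asm) G'[where h' = "\<lambda>p. laurent_monomial d' E' p y * (\<Sum>m<d'. real_of_int (E' p m) * v (d + m))"])
          (use n0 in \<open>simp_all add: lin lin' mono' E0 E'0 del: sum.lessThan_Suc\<close>)
    qed
    show "v m = 0"
    proof (cases "m < d")
      case True
      thus ?thesis using x' v1 unfolding laurent_solutions_def by blast
    next
      case False
      define m' where "m' = m - d"
      have m': "m = d + m'" "m' < d'" using False m by (auto simp: m'_def)
      have "\<forall>w. (\<forall>i<d'. (\<Sum>p<Suc (d' + k'). C' i p * laurent_monomial d' E' p y *
          (\<Sum>m<d'. real_of_int (E' p m) * w m)) = 0) \<longrightarrow> (\<forall>m<d'. w m = 0)"
        using y' unfolding laurent_solutions_def by blast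
      from spec[OF this, of "\<lambda>m. v (d + m)"] v2 m' show ?thesis by blast
    qed
  qed
  have inj: "inj_on (\<lambda>(x, y). glue x y) (X \<times> X')"
  proof (rule inj_onI, clarify)
    fix x y x' y' assume mem: "x \<in> X" "y \<in> X'" "x' \<in> X" "y' \<in> X'" and eq: "glue x y = glue x' y'"
    have "x = x'"
    proof (rule PiE_ext[where k = "{..<d}" and s = "\<lambda>_. {0<..}"])
      show "x \<in> {..<d} \<rightarrow>\<^sub>E {0<..}" "x' \<in> {..<d} \<rightarrow>\<^sub>E {0<..}"
        using mem X by (auto simp: laurent_solutions_def)
      show "x m = x' m" if "m \<in> {..<d}" for m
        using fun_cong[OF eq, of m] that by (simp add: glue_def)
    qed
    moreover have "y = y'"
    proof
      fix m show "y m = y' m" using fun_cong[OF eq, of "d + m"] by (simp add: glue_def)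
    qed
    ultimately show "x = x' \<and> y = y'" by simp
  qed
  have n_eq: "n + (d' + k') = d + d' + (k + k') + 1" by (simp add: n_def)
  show ?thesis unfolding realizable_def
  proof (intro exI conjI)
    show "(\<lambda>(x, y). glue x y) ` (X \<times> X') \<subseteq> laurent_solutions (d + d') (d + d' + (k + k') + 1) F G"
      using sol unfolding n_eq by auto
    show "finite ((\<lambda>(x, y). glue x y) ` (X \<times> X'))" using X X' by simp
    show "card ((\<lambda>(x, y). glue x y) ` (X \<times> X')) = N * N'"
      using inj X X' by (simp add: card_image card_cartesian_product)
  qed
qed

text \<open>The witness is the system \<open>x i = 1\<close> for \<open>i < d\<close>, with the
  constant monomial at index \<open>0\<close>. As a factor in \<open>realizable_mult\<close> it pads
  \<open>d\<close> and \<open>k\<close> to larger values.\<close>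

lemma realizable_one: "realizable d k 1"
proof -
  define E :: "nat \<Rightarrow> nat \<Rightarrow> int" where "E = (\<lambda>p m. if p = Suc m then 1 else 0)"
  define C :: "nat \<Rightarrow> nat \<Rightarrow> real" where "C = (\<lambda>i p. (if p = Suc i then 1 else 0) - (if p = 0 then 1 else 0))"
  define x :: "nat \<Rightarrow> real" where "x = (\<lambda>m\<in>{..<d}. 1)"
  have mono: "laurent_monomial d E p x = 1" for p by (simp add: laurent_monomial_def x_def)
  have C: "(\<Sum>p<d + k + 1. C i p * h p) = h (Suc i) - h 0" if "i < d" for i h
  proof -
    have "(\<Sum>p<d + k + 1. C i p * h p) =
        (\<Sum>p<d + k + 1. if p = Suc i then h p else 0) - (\<Sum>p<d + k + 1. if p = 0 then h p else 0)"
      unfolding sum_subtractf[symmetric] by (intro sum.cong refl) (simp add: C_def)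
    also have "(\<Sum>p<d + k + 1. if p = Suc i then h p else 0) = h (Suc i)"
      using that by (subst sum.delta) auto
    also have "(\<Sum>p<d + k + 1. if p = 0 then h p else 0) = h 0" by (subst sum.delta) auto
    finally show ?thesis .
  qed
  have lin: "(\<Sum>m<d. real_of_int (E (Suc i) m) * v m) = v i" if "i < d" for i v
  proof -
    have "(\<Sum>m<d. real_of_int (E (Suc i) m) * v m) = (\<Sum>m<d. if m = i then v m else 0)"
      by (intro sum.cong) (auto simp: E_def)
    with that show ?thesis by simp
  qed
  have lin0: "(\<Sum>m<d. real_of_int (E 0 m) * v m) = 0" for v by (simp add: E_def)
  have "x \<in> laurent_solutions d (d + k + 1) E C"
    unfolding laurent_solutions_def mem_Collect_eq mono
  proof (intro conjI allI impI)
    show "x \<in> {..<d} \<rightarrow>\<^sub>E {0<..}" by (auto simp: x_def)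
    show "(\<Sum>p<d + k + 1. C i p * 1) = 0" if "i < d" for i using C[OF that, of "\<lambda>_. 1"] by simp
    fix v m assume v: "\<forall>i<d. (\<Sum>p<d + k + 1. C i p * 1 * (\<Sum>m<d. real_of_int (E p m) * v m)) = 0" and m: "m < d"
    from spec[OF v, of m] m C[OF m, of "\<lambda>p. \<Sum>m<d. real_of_int (E p m) * v m"]
    show "v m = 0" by (simp add: lin lin0 del: sum.lessThan_Suc)
  qed
  thus ?thesis unfolding realizable_def by (intro exI[of _ E] exI[of _ C] exI[of _ "{x}"]) auto
qed

lemma realizable_add: "realizable d k N \<Longrightarrow> realizable (d + d') (k + k') N"
  using realizable_mult[OF _ realizable_one, of d k N d' k'] by simp

lemma realizable_power: "realizable d k N \<Longrightarrow> realizable (d * q) (k * q) (N ^ q)"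
proof (induction q)
  case 0
  show ?case using realizable_one[of 0 0] by simp
next
  case (Suc q)
  thus ?case using realizable_mult[of d k N "d * q" "k * q" "N ^ q"] by simp
qed

section \<open>Systems built from two orders of the nodes\<close>

lemma poly_eq_sum_coeff:
  fixes Q :: "real poly"
  assumes "degree Q \<le> n"
  shows "poly Q u = (\<Sum>i\<le>n. poly.coeff Q i * u ^ i)"
  unfolding poly_altdef using assms by (intro sum.mono_neutral_left) (auto simp: coeff_eq_0)

text \<open>
  Substituting \<open>x m = exp (coefficient of t\<^sup>m\<^sup>+\<^sup>1)\<close> turns the monomials with exponents
  \<open>t p ^ (m + 1)\<close> into values \<open>exp (Q (t p))\<close> of a polynomial \<open>Q\<close> of degree \<open>d + 1\<close>, whose leading
  coefficient \<open>- L\<close> is built into the coefficients of the system. The linear equations say that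
  these values are interpolated at the nodes \<open>s p\<close> by a polynomial of degree at most \<open>k\<close>.
\<close>

lemma realizable_from_nodes:
  fixes s :: "nat \<Rightarrow> real" and t :: "nat \<Rightarrow> nat"
  assumes inj: "inj_on s {..d + k}" "inj_on t {..d + k}"
    and fam: "\<And>B. B \<in> \<B> \<Longrightarrow> B \<subseteq> {..d + k}" "\<And>B. B \<in> \<B> \<Longrightarrow> card B = k"
    and pos_t: "\<And>B b. B \<in> \<B> \<Longrightarrow> b \<in> B \<Longrightarrow> (\<Prod>a\<in>{..d + k} - B. real (t b) - real (t a)) > 0"
    and pos_s: "\<And>B a. B \<in> \<B> \<Longrightarrow> a \<in> {..d + k} - B \<Longrightarrow> (\<Prod>b\<in>B. s a - s b) > 0"
  shows "realizable d k (card \<B>)"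
proof -
  have fin\<B>: "finite \<B>" by (rule finite_subset[of _ "Pow {..d + k}"]) (use fam in auto)
  define good where "good = (\<lambda>B L P Q. degree P \<le> k \<and> degree Q \<le> Suc d \<and> poly.coeff Q (Suc d) = - L \<and>
    (\<forall>p\<le>d + k. poly P (s p) = exp (poly Q (real (t p)))) \<and>
    (\<forall>a\<in>{..d + k} - B. \<forall>b\<in>B. poly P (s b) < poly P (s a)) \<and>
    (\<forall>V R. degree V \<le> d \<longrightarrow> degree R \<le> k \<longrightarrow>
       (\<forall>p\<le>d + k. poly V (real (t p)) * poly P (s p) = poly R (s p)) \<longrightarrow> degree V = 0))"
  have "\<exists>L0. \<forall>L\<ge>L0. \<exists>P Q. good B L P Q" if B: "B \<in> \<B>" for B
  proof -
    have sub: "B \<subseteq> {..d + k}" and cB: "card B = k" using fam B by auto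
    have finB: "finite B" using sub finite_subset by blast
    have un: "({..d + k} - B) \<union> B = {..d + k}" using sub by blast
    have ball: "(\<forall>p\<in>{..d + k}. Z p) \<longleftrightarrow> (\<forall>p\<le>d + k. Z p)" for Z by auto
    have "card ({..d + k} - B) = Suc d" using sub cB finB by (simp add: card_Diff_subset)
    from exp_interpolation[of "{..d + k} - B" B s "\<lambda>p. real (t p)" d k, unfolded un ball, OF _ finB _ _ this cB pos_t[OF B] pos_s[OF B]]
    show ?thesis unfolding good_def
      using inj_on_subset[OF inj(1) sub] inj_on_subset[OF inj(2), of "{..d + k} - B"]
      by (simp add: inj_on_def)
  qed
  then obtain L0 where L0: "\<And>B L. B \<in> \<B> \<Longrightarrow> L0 B \<le> L \<Longrightarrow> \<exists>P Q. good B L P Q" by metis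
  \<comment> \<open>One \<open>L\<close> has to serve all \<open>B\<close>, since it enters the
    coefficients of the system.\<close>
  define L where "L = Max (insert 0 (L0 ` \<B>))"
  have "L0 B \<le> L" if "B \<in> \<B>" for B unfolding L_def using fin\<B> that by (intro Max_ge) auto
  hence "\<exists>P Q. good B L P Q" if "B \<in> \<B>" for B using L0[OF that] that by blast
  then obtain P Q where good: "\<And>B. B \<in> \<B> \<Longrightarrow> good B L (P B) (Q B)" by metis
  define x where "x = (\<lambda>B. \<lambda>m\<in>{..<d}. exp (poly.coeff (Q B) (Suc m)))"
  define c where "c = (\<lambda>B. exp (poly.coeff (Q B) 0))"
  define E where "E = (\<lambda>p m. int (t p ^ Suc m))"
  \<comment> \<open>The weight supplies the factor of \<open>exp (Q (t p))\<close> that comes from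
    the fixed top coefficient \<open>- L\<close>.\<close>
  define \<epsilon> where "\<epsilon> = (\<lambda>p. exp (- L * real (t p) ^ Suc d))"
  \<comment> \<open>Row \<open>i\<close> says that the value at node \<open>k + 1 + i\<close> is the
    one extrapolated from the nodes \<open>0\<close> to \<open>k\<close> by a polynomial of degree
    at most \<open>k\<close>.\<close>
  define D where "D = (\<lambda>i p. (if p = Suc (k + i) then 1 else 0) -
     (if p \<le> k then poly (lagrange_basis s {..k} p) (s (Suc (k + i))) else 0))"
  define C where "C = (\<lambda>i p. \<epsilon> p * D i p)"
  have D: "(\<Sum>p<d + k + 1. D i p * g p) =
      g (Suc (k + i)) - (\<Sum>p\<le>k. g p * poly (lagrange_basis s {..k} p) (s (Suc (k + i))))"
    if "i < d" for i g
  proof -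
    have "(\<Sum>p<d + k + 1. D i p * g p) = (\<Sum>p<d + k + 1. if p = Suc (k + i) then g p else 0) -
        (\<Sum>p<d + k + 1. if p \<le> k then g p * poly (lagrange_basis s {..k} p) (s (Suc (k + i))) else 0)"
      unfolding D_def sum_subtractf[symmetric] by (intro sum.cong refl) (auto simp: algebra_simps)
    also have "(\<Sum>p<d + k + 1. if p = Suc (k + i) then g p else 0) = g (Suc (k + i))"
      using that by (subst sum.delta) auto
    also have "(\<Sum>p<d + k + 1. if p \<le> k then g p * poly (lagrange_basis s {..k} p) (s (Suc (k + i))) else 0) =
        (\<Sum>p\<le>k. g p * poly (lagrange_basis s {..k} p) (s (Suc (k + i))))"
      by (subst sum.inter_filter[symmetric]) (auto intro!: sum.cong)
    finally show ?thesis .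
  qed
  have inj_k: "inj_on s {..k}" by (rule inj_on_subset[OF inj(1)]) auto
  \<comment> \<open>The constant coefficient of \<open>Q B\<close> is not a coordinate of
    \<open>x B\<close>, so the weighted monomials give \<open>P B\<close> only up to the factor
    \<open>c B\<close>, which the homogeneous linear equations permit.\<close>
  have mono: "\<epsilon> p * laurent_monomial d E p (x B) = poly (P B) (s p) / c B"
    if B: "B \<in> \<B>" and p: "p \<le> d + k" for B p
  proof -
    have powi: "exp y powi int N = exp (y * real N)" for y :: real and N
      by (simp add: exp_of_nat2_mult)
    have "laurent_monomial d E p (x B) = (\<Prod>m<d. exp (poly.coeff (Q B) (Suc m) * real (t p) ^ Suc m))"
      unfolding laurent_monomial_def E_def x_def
      by (intro prod.cong refl) (simp only: restrict_apply if_True powi, simp)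
    also have "\<dots> = exp (\<Sum>m<d. poly.coeff (Q B) (Suc m) * real (t p) ^ Suc m)"
      by (simp add: exp_sum)
    finally have "\<epsilon> p * laurent_monomial d E p (x B) * c B = exp (poly.coeff (Q B) 0 +
        (\<Sum>m<d. poly.coeff (Q B) (Suc m) * real (t p) ^ Suc m) + poly.coeff (Q B) (Suc d) * real (t p) ^ Suc d)"
      using good[OF B] by (simp add: good_def \<epsilon>_def c_def exp_add[symmetric] add_ac)
    also have "\<dots> = exp (poly (Q B) (real (t p)))"
      using good[OF B]
      by (subst poly_eq_sum_coeff[of "Q B" "Suc d"])
        (simp_all add: good_def sum.atMost_shift[of _ d] add.assoc del: power_Suc)
    also have "\<dots> = poly (P B) (s p)" using good[OF B] p by (simp add: good_def)
    finally show ?thesis by (simp add: c_def field_simps)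
  qed
  have sol: "x B \<in> laurent_solutions d (d + k + 1) E C" if B: "B \<in> \<B>" for B
    unfolding laurent_solutions_def mem_Collect_eq
  proof (intro conjI allI impI)
    have degP: "degree (P B) \<le> k" using good[OF B] by (simp add: good_def)
    have C_mono: "C i p * laurent_monomial d E p (x B) = D i p * (poly (P B) (s p) / c B)"
      if "p < d + k + 1" for i p
      using arg_cong[OF mono[OF B, of p], of "(*) (D i p)"] that by (simp add: C_def mult_ac)
    show "x B \<in> {..<d} \<rightarrow>\<^sub>E {0<..}" by (auto simp: x_def)
    show "(\<Sum>p<d + k + 1. C i p * laurent_monomial d E p (x B)) = 0" if i: "i < d" for i
    proof -
      have "(\<Sum>p<d + k + 1. C i p * laurent_monomial d E p (x B)) =
          (\<Sum>p<d + k + 1. D i p * (poly (P B) (s p) / c B))"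
        by (intro sum.cong refl C_mono) auto
      also have "\<dots> = (poly (P B) (s (Suc (k + i))) -
          (\<Sum>p\<le>k. poly (P B) (s p) * poly (lagrange_basis s {..k} p) (s (Suc (k + i))))) / c B"
        unfolding D[OF i] by (simp add: diff_divide_distrib sum_divide_distrib)
      also have "\<dots> = 0"
        using degP by (subst poly_eq_interpolation[OF _ inj_k, of "P B"]) (auto simp: coeff_eq_0)
      finally show ?thesis .
    qed
    fix v m
    assume v: "\<forall>i<d. (\<Sum>p<d + k + 1. C i p * laurent_monomial d E p (x B) *
      (\<Sum>m<d. real_of_int (E p m) * v m)) = 0" and m: "m < d"
    \<comment> \<open>A kernel vector is read as a polynomial without constant term, a variation of
      \<open>Q B\<close>. Once \<open>V\<close> is known to be constant, \<open>v\<close>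
      vanishes.\<close>
    define V where "V = (\<Sum>m<d. Polynomial.monom (v m) (Suc m))"
    have poly_V: "poly V (real (t p)) = (\<Sum>m<d. real_of_int (E p m) * v m)" for p
      by (simp add: V_def poly_sum poly_monom E_def mult_ac)
    have coeff_V: "poly.coeff V (Suc m) = (if m < d then v m else 0)" for m
      by (simp add: V_def coeff_sum)
    have degV: "degree V \<le> d"
    proof (rule degree_le, intro allI impI)
      fix i assume "d < i"
      thus "poly.coeff V i = 0" using coeff_V[of "i - 1"] by (cases i) auto
    qed
    define R where "R = interpolant s {..k} (\<lambda>p. poly V (real (t p)) * poly (P B) (s p))"
    have degR: "degree R \<le> k"
      unfolding R_def by (intro degree_le) (simp add: coeff_interpolant)
    have "poly V (real (t p)) * poly (P B) (s p) = poly R (s p)" if p: "p \<le> d + k" for p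
    proof (cases "p \<le> k")
      case True
      thus ?thesis unfolding R_def using inj_k by (subst poly_interpolant_node) auto
    next
      case False
      define i where "i = p - Suc k"
      have i: "i < d" and p_eq: "p = Suc (k + i)" using False p by (auto simp: i_def)
      have "0 = (\<Sum>p<d + k + 1. C i p * laurent_monomial d E p (x B) * poly V (real (t p)))"
        using v i by (simp add: poly_V del: sum.lessThan_Suc)
      also have "\<dots> = (\<Sum>p<d + k + 1. D i p * (poly V (real (t p)) * poly (P B) (s p) / c B))"
        by (intro sum.cong refl) (simp add: C_mono del: sum.lessThan_Suc)
      also have "\<dots> = (poly V (real (t p)) * poly (P B) (s p) - poly R (s p)) / c B"
        unfolding D[OF i] p_eq R_def poly_interpolant by (simp add: diff_divide_distrib sum_divide_distrib)
      finally show ?thesis by (simp add: c_def)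
    qed
    hence "degree V = 0" using good[OF B] degV degR unfolding good_def by blast
    thus "v m = 0" using coeff_V[of m] m by (simp add: coeff_eq_0)
  qed
  have order: "poly (P B) (s b) / c B < poly (P B) (s a) / c B"
    if "B \<in> \<B>" "b \<in> B" "a \<in> {..d + k} - B" for B a b
  proof -
    have "poly (P B) (s b) < poly (P B) (s a)" using good[OF that(1)] that unfolding good_def by blast
    thus ?thesis by (simp add: c_def divide_strict_right_mono)
  qed
  \<comment> \<open>The point \<open>x B\<close> determines the values of \<open>P B\<close> at the
    nodes up to a positive factor. If \<open>x B = x B'\<close>, these values would order an element
    of \<open>B - B'\<close> and one of \<open>B' - B\<close> in both ways.\<close>
  have inj_x: "inj_on x \<B>"
  proof (rule inj_onI, rule ccontr)
    fix B B' assume B: "B \<in> \<B>" and B': "B' \<in> \<B>" and eq: "x B = x B'" and ne: "B \<noteq> B'"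
    have fin: "finite B" "finite B'" using fam(1)[OF B] fam(1)[OF B'] finite_subset by blast+
    have "\<not> B \<subseteq> B'" "\<not> B' \<subseteq> B"
      using ne fam(2)[OF B] fam(2)[OF B'] card_subset_eq[of B' B] card_subset_eq[of B B'] fin by auto
    then obtain b b' where b: "b \<in> B" "b \<notin> B'" and b': "b' \<in> B'" "b' \<notin> B" by blast
    have le: "b \<le> d + k" "b' \<le> d + k" using b b' fam(1)[OF B] fam(1)[OF B'] by auto
    have "poly (P B) (s b) / c B < poly (P B) (s b') / c B" using b b' le B by (intro order) auto
    moreover have "poly (P B') (s b') / c B' < poly (P B') (s b) / c B'" using b b' le B' by (intro order) auto
    ultimately show False
      using le by (simp flip: mono[OF B] mono[OF B'] add: eq)
  qed
  show ?thesis unfolding realizable_def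
    using sol inj_x fin\<B> by (intro exI[of _ E] exI[of _ C] exI[of _ "x ` \<B>"]) (auto simp: card_image)
qed

subsection \<open>Counting by Delannoy paths\<close>

text \<open>The negative factors are exactly those with \<open>f b > x\<close>, so their number
  decides the sign.\<close>

lemma prod_diff_pos_if_even:
  fixes f :: "'a \<Rightarrow> nat"
  assumes fin: "finite S" and ne: "\<And>b. b \<in> S \<Longrightarrow> f b \<noteq> x" and ev: "even (card {b \<in> S. x < f b})"
  shows "(\<Prod>b\<in>S. real x - real (f b)) > 0"
proof -
  let ?U = "{b \<in> S. x < f b}" and ?D = "{b \<in> S. f b < x}"
  have "S = ?U \<union> ?D" using ne by (auto simp: neq_iff)
  hence "(\<Prod>b\<in>S. real x - real (f b)) = (\<Prod>b\<in>?U \<union> ?D. real x - real (f b))" by simp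
  also have "\<dots> = (\<Prod>b\<in>?U. real x - real (f b)) * (\<Prod>b\<in>?D. real x - real (f b))"
    using fin by (intro prod.union_disjoint) auto
  also have "(\<Prod>b\<in>?U. real x - real (f b)) = (\<Prod>b\<in>?U. - 1 * (real (f b) - real x))"
    by simp
  also have "\<dots> = (\<Prod>b\<in>?U. real (f b) - real x)"
    using ev unfolding prod.distrib by simp
  finally have "(\<Prod>b\<in>S. real x - real (f b)) =
      (\<Prod>b\<in>?U. real (f b) - real x) * (\<Prod>b\<in>?D. real x - real (f b))" .
  moreover have "(\<Prod>b\<in>?U. real (f b) - real x) > 0" by (intro prod_pos) auto
  moreover have "(\<Prod>b\<in>?D. real x - real (f b)) > 0" by (intro prod_pos) auto
  ultimately show ?thesis by simp
qed

lemma card_nth_greater_eq: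
  "card {q. q < length u \<and> p < q \<and> Z (u ! q)} = length (filter Z (drop (Suc p) u))"
proof -
  have "{q. q < length u \<and> p < q \<and> Z (u ! q)} =
      (\<lambda>i. Suc p + i) ` {i. i < length (drop (Suc p) u) \<and> Z (drop (Suc p) u ! i)}"
  proof (intro equalityI subsetI)
    fix q assume "q \<in> {q. q < length u \<and> p < q \<and> Z (u ! q)}"
    thus "q \<in> (\<lambda>i. Suc p + i) ` {i. i < length (drop (Suc p) u) \<and> Z (drop (Suc p) u ! i)}"
      by (intro image_eqI[of _ _ "q - Suc p"]) auto
  qed auto
  thus ?thesis by (simp add: length_filter_conv_card card_image inj_on_def)
qed

datatype step = Horizontal | Vertical | Diagonal

text \<open>
  The entry \<open>True\<close> marks an element of \<open>B\<close>. Swapping the positions \<open>2 l\<close> and \<open>2 l + 1\<close> turns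
  \<open>colours w\<close> into \<open>swapped_colours w\<close>. In \<open>colours w\<close> the maximal blocks of \<open>False\<close> have even
  length, in \<open>swapped_colours w\<close> those of \<open>True\<close> have. This is Gale's evenness condition for
  the complement of \<open>B\<close> in the first order and for \<open>B\<close> in the second.
\<close>

fun colours :: "step list \<Rightarrow> bool list" where
  "colours [] = []"
| "colours (Horizontal # w) = False # False # colours w"
| "colours (Vertical # w) = True # True # colours w"
| "colours (Diagonal # w) = True # False # False # True # colours w"

fun swapped_colours :: "step list \<Rightarrow> bool list" where
  "swapped_colours [] = []"
| "swapped_colours (Horizontal # w) = False # False # swapped_colours w"
| "swapped_colours (Vertical # w) = True # True # swapped_colours w"
| "swapped_colours (Diagonal # w) = False # True # True # False # swapped_colours w"

definition swap :: "nat \<Rightarrow> nat" where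
  "swap p = (if even p then Suc p else p - 1)"

lemma swap_simps [simp]: "swap 0 = Suc 0" "swap (Suc 0) = 0" "swap (Suc (Suc p)) = Suc (Suc (swap p))"
  by (auto simp: swap_def elim: oddE)

lemma swap_swap [simp]: "swap (swap p) = p"
  by (auto simp: swap_def elim: oddE)

lemma swap_less_iff: "even n \<Longrightarrow> swap p < n \<longleftrightarrow> p < n"
  by (auto simp: swap_def elim!: oddE evenE)

lemma even_length_colours: "even (length (colours w))"
  by (induction w rule: colours.induct) auto

lemma length_swapped_colours: "length (swapped_colours w) = length (colours w)"
  by (induction w rule: colours.induct) auto

lemma swapped_colours_nth:
  "p < length (colours w) \<Longrightarrow> swapped_colours w ! swap p = colours w ! p"
proof (induction w arbitrary: p rule: colours.induct)
  case (2 w)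
  thus ?case by (auto simp: less_Suc_eq_0_disj)
next
  case (3 w)
  thus ?case by (auto simp: less_Suc_eq_0_disj)
next
  case (4 w)
  thus ?case by (auto simp: less_Suc_eq_0_disj)
qed auto

text \<open>The first two entries of a block determine its step, so \<open>colours\<close> is a
  prefix code.\<close>

lemma inj_colours: "colours v = colours w \<Longrightarrow> v = w"
proof (induction v arbitrary: w rule: colours.induct)
  case 1
  thus ?case by (cases w rule: colours.cases) auto
next
  case (2 v)
  thus ?case by (cases w rule: colours.cases) auto
next
  case (3 v)
  thus ?case by (cases w rule: colours.cases) auto
next
  case (4 v)
  thus ?case by (cases w rule: colours.cases) auto
qed

lemma even_False_colours: "even (length (filter Not (colours w)))"
  by (induction w rule: colours.induct) auto

lemma even_True_swapped_colours: "even (length (filter (\<lambda>x. x) (swapped_colours w)))"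
  by (induction w rule: colours.induct) auto

text \<open>Every block contains an even number of \<open>False\<close>, and inside its block each
  \<open>True\<close> is followed by either none or two of them.\<close>

lemma even_False_after_True:
  "p < length (colours w) \<Longrightarrow> colours w ! p \<Longrightarrow> even (length (filter Not (drop (Suc p) (colours w))))"
proof (induction w arbitrary: p rule: colours.induct)
  case (2 w)
  thus ?case by (auto simp: less_Suc_eq_0_disj even_False_colours)
next
  case (3 w)
  thus ?case by (auto simp: less_Suc_eq_0_disj even_False_colours)
next
  case (4 w)
  thus ?case by (auto simp: less_Suc_eq_0_disj even_False_colours)
qed auto

text \<open>The same parity check by blocks with the two colours exchanged; the diagonal block is
  now \<open>False\<close>, \<open>True\<close>, \<open>True\<close>, \<open>False\<close>.\<close>

lemma even_True_after_False:
  "p < length (swapped_colours w) \<Longrightarrow> \<not> swapped_colours w ! p \<Longrightarrow>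
    even (length (filter (\<lambda>x. x) (drop (Suc p) (swapped_colours w))))"
proof (induction w arbitrary: p rule: colours.induct)
  case (2 w)
  thus ?case by (auto simp: less_Suc_eq_0_disj even_True_swapped_colours)
next
  case (3 w)
  thus ?case by (auto simp: less_Suc_eq_0_disj even_True_swapped_colours)
next
  case (4 w)
  thus ?case by (auto simp: less_Suc_eq_0_disj even_True_swapped_colours)
qed auto

lemma length_colours:
  "length (colours w) = 2 * count (mset w) Horizontal + 2 * count (mset w) Vertical + 4 * count (mset w) Diagonal"
  by (induction w rule: colours.induct) auto

lemma length_True_colours:
  "length (filter (\<lambda>x. x) (colours w)) = 2 * count (mset w) Vertical + 2 * count (mset w) Diagonal"
  by (induction w rule: colours.induct) auto

definition true_positions :: "bool list \<Rightarrow> nat set" where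
  "true_positions u = {p. p < length u \<and> u ! p}"

text \<open>\<open>N\<close> counts the words with \<open>a\<close> horizontal, \<open>b\<close>
  vertical and \<open>c\<close> diagonal steps. Each word yields \<open>2 * (b + c)\<close> entries
  \<open>True\<close>, the \<open>k\<close> elements of \<open>B\<close>, and
  \<open>2 * (a + c)\<close> entries \<open>False\<close>, the \<open>d + 1\<close> elements of the
  complement; hence the value of \<open>d\<close>, where the hypothesis makes the subtraction
  exact.\<close>

lemma realizable_multinomial:
  assumes n: "a + c > 0"
  obtains N where "realizable (2 * (a + c) - 1) (2 * (b + c)) N"
    "N * (fact a * fact b * fact c) = fact (a + b + c)"
proof -
  define M where "M = replicate_mset a Horizontal + replicate_mset b Vertical + replicate_mset c Diagonal"
  define W where "W = permutations_of_multiset M"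
  define d where "d = 2 * (a + c) - 1"
  define k where "k = 2 * (b + c)"
  have mset: "mset w = M" if "w \<in> W" for w using that by (simp add: W_def permutations_of_multiset_def)
  have len: "length (colours w) = Suc (d + k)" if "w \<in> W" for w
    using n by (simp add: length_colours mset[OF that] M_def d_def k_def)
  define S where "S = (\<lambda>w. true_positions (colours w))"
  have inj: "inj_on S W"
  proof (rule inj_onI)
    fix v w assume vw: "v \<in> W" "w \<in> W" "S v = S w"
    have "colours v = colours w"
      using vw len by (intro nth_equalityI) (auto simp: S_def true_positions_def set_eq_iff)
    thus "v = w" by (rule inj_colours)
  qed
  \<comment> \<open>The exponents follow the first order, the identity; the interpolation nodes
    follow the second, given by \<open>swap\<close>.\<close>
  have "realizable d k (card (S ` W))"
  proof (rule realizable_from_nodes[of "\<lambda>p. real (swap p)" d k "\<lambda>p. p"])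
    show "inj_on (\<lambda>p. real (swap p)) {..d + k}" by (rule inj_onI) (metis of_nat_eq_iff swap_swap)
    show "inj_on (\<lambda>p. p) {..d + k}" by simp
    fix B assume "B \<in> S ` W"
    then obtain w where w: "w \<in> W" and B: "B = S w" by blast
    have mem_B: "p \<in> B \<longleftrightarrow> p < Suc (d + k) \<and> colours w ! p" for p
      by (simp add: B S_def true_positions_def len[OF w])
    show sub: "B \<subseteq> {..d + k}" by (auto simp: mem_B)
    have finB: "finite B" using sub finite_subset by blast
    have "card B = length (filter (\<lambda>x. x) (colours w))"
      by (simp add: B S_def true_positions_def length_filter_conv_card)
    thus "card B = k" by (simp add: length_True_colours mset[OF w] M_def k_def)
    show "(\<Prod>a\<in>{..d + k} - B. real b - real a) > 0" if b: "b \<in> B" for b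
    proof (rule prod_diff_pos_if_even)
      have eq: "{a \<in> {..d + k} - B. b < a} = {q. q < length (colours w) \<and> b < q \<and> \<not> colours w ! q}"
        by (auto simp: mem_B len[OF w])
      show "even (card {a \<in> {..d + k} - B. b < a})"
        unfolding eq card_nth_greater_eq[of "colours w" b Not]
        using even_False_after_True[of b w] b by (simp add: mem_B len[OF w])
    qed (use b in auto)
    show "(\<Prod>b\<in>B. real (swap a) - real (swap b)) > 0" if a: "a \<in> {..d + k} - B" for a
    proof (rule prod_diff_pos_if_even)
      have ev: "even (Suc (d + k))" using even_length_colours[of w] len[OF w] by simp
      have col: "swapped_colours w ! q = colours w ! swap q" if "q < Suc (d + k)" for q
        using swapped_colours_nth[of "swap q" w] that ev by (simp add: swap_less_iff len[OF w])
      \<comment> \<open>Counting the elements of \<open>B\<close> above \<open>a\<close> in the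
        second order becomes counting entries \<open>True\<close> of
        \<open>swapped_colours w\<close> behind position \<open>swap a\<close>.\<close>
      have "swap ` {b \<in> B. swap a < swap b} =
        {q. q < length (swapped_colours w) \<and> swap a < q \<and> swapped_colours w ! q}"
      proof (intro equalityI subsetI)
        fix q assume "q \<in> {q. q < length (swapped_colours w) \<and> swap a < q \<and> swapped_colours w ! q}"
        thus "q \<in> swap ` {b \<in> B. swap a < swap b}"
          using ev by (intro image_eqI[of _ _ "swap q"])
            (auto simp: mem_B col swap_less_iff length_swapped_colours len[OF w] simp del: even_Suc)
      qed (use ev in \<open>auto simp: mem_B col swap_less_iff length_swapped_colours len[OF w] simp del: even_Suc\<close>)
      moreover have "inj_on swap X" for X by (rule inj_onI) (metis swap_swap)
      ultimately have "card {b \<in> B. swap a < swap b} =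
          length (filter (\<lambda>x. x) (drop (Suc (swap a)) (swapped_colours w)))"
        using card_image[of swap "{b \<in> B. swap a < swap b}"]
          card_nth_greater_eq[of "swapped_colours w" "swap a" "\<lambda>x. x"] by simp
      moreover have "swap a < Suc (d + k)" "\<not> swapped_colours w ! swap a"
        using a ev by (auto simp: swap_less_iff mem_B col simp del: even_Suc)
      ultimately show "even (card {b \<in> B. swap a < swap b})"
        using even_True_after_False[of "swap a" w] by (simp add: length_swapped_colours len[OF w])
    qed (use a finB in \<open>auto dest: arg_cong[of _ _ swap]\<close>)
  qed
  moreover have "card (S ` W) = card W" by (rule card_image) (rule inj)
  moreover have "card W * (fact a * fact b * fact c) = fact (a + b + c)"
  proof -
    have "(\<Prod>x\<in>set_mset M. fact (count M x)) = (\<Prod>x\<in>{Horizontal, Vertical, Diagonal}. fact (count M x) :: nat)"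
      by (intro prod.mono_neutral_left) (auto simp: not_in_iff[symmetric] M_def split: if_splits)
    also have "\<dots> = fact a * fact b * fact c" by (simp add: M_def)
    finally show ?thesis
      using card_permutations_of_multiset_aux[of M] by (simp add: W_def M_def)
  qed
  ultimately show ?thesis using that unfolding d_def k_def by simp
qed

section \<open>Asymptotics of factorials and multinomial coefficients\<close>

lemma ln_fact_ge: "real n * ln (real n) - real n \<le> ln (fact n)"
proof (induction n)
  case (Suc n)
  have "real n * (ln (real (Suc n)) - ln (real n)) \<le> 1"
  proof (cases "n = 0")
    case False
    hence "real n * (ln (real (Suc n)) - ln (real n)) \<le> real n * ((real (Suc n) - real n) / real n)"
      by (intro mult_left_mono ln_diff_le) auto
    with False show ?thesis by simp
  qed simp
  hence "real (Suc n) * ln (real (Suc n)) - real (Suc n) \<le>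
      ln (real (Suc n)) + (real n * ln (real n) - real n)"
    by (simp add: algebra_simps)
  also have "\<dots> \<le> ln (real (Suc n)) + ln (fact n)" using Suc.IH by simp
  also have "\<dots> = ln (fact (Suc n))" unfolding fact_Suc by (subst ln_mult) auto
  finally show ?case .
qed simp

text \<open>The shift to \<open>Suc n\<close> absorbs the square root factor of Stirling's formula
  at a cost of order \<open>ln n\<close>, which disappears after the later division by
  \<open>m\<close>.\<close>

lemma ln_fact_le: "ln (fact n) \<le> real (Suc n) * ln (real (Suc n)) - real n"
proof (induction n)
  case (Suc n)
  have "ln (real (Suc n)) - ln (real (Suc (Suc n))) \<le>
      (real (Suc n) - real (Suc (Suc n))) / real (Suc (Suc n))"
    by (intro ln_diff_le) auto
  hence "real (Suc (Suc n)) * (ln (real (Suc n)) - ln (real (Suc (Suc n)))) \<le>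
      real (Suc (Suc n)) * ((real (Suc n) - real (Suc (Suc n))) / real (Suc (Suc n)))"
    by (intro mult_left_mono) auto
  also have "\<dots> = - 1" by (simp add: field_simps)
  finally have "real (Suc (Suc n)) * (ln (real (Suc n)) - ln (real (Suc (Suc n)))) \<le> - 1" .
  hence *: "ln (real (Suc n)) + (real (Suc n) * ln (real (Suc n)) - real n) \<le>
      real (Suc (Suc n)) * ln (real (Suc (Suc n))) - real (Suc n)"
    unfolding right_diff_distrib by (simp add: algebra_simps)
  have "ln (fact (Suc n)) = ln (real (Suc n)) + ln (fact n)" unfolding fact_Suc by (subst ln_mult) auto
  with * Suc.IH show ?case by linarith
qed simp

text \<open>Stirling's formula for arguments of linear growth. The subtracted multiple of
  \<open>ln m\<close> is the part of larger order; in a multinomial coefficient these parts cancel,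
  because the lower arguments add up to the upper one.\<close>

lemma tendsto_ln_fact:
  fixes a :: "nat \<Rightarrow> nat"
  assumes a: "(\<lambda>m. real (a m) / real m) \<longlonglongrightarrow> \<alpha>" and \<alpha>: "\<alpha> > 0"
  shows "(\<lambda>m. ln (fact (a m)) / real m - real (a m) / real m * ln (real m)) \<longlonglongrightarrow> \<alpha> * ln \<alpha> - \<alpha>"
proof (rule tendsto_sandwich)
  have pos: "eventually (\<lambda>m. real (a m) / real m > 0) sequentially"
    using order_tendstoD(1)[OF a \<alpha>] .
  have m_pos: "eventually (\<lambda>m::nat. m > 0) sequentially" by (rule eventually_gt_at_top)
  have inv: "(\<lambda>m. 1 / real m) \<longlonglongrightarrow> 0" by (rule lim_1_over_n)
  have ln_m: "(\<lambda>m. ln (real m) / real m) \<longlonglongrightarrow> 0" by (rule lim_ln_over_n)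
  have a1: "(\<lambda>m. real (Suc (a m)) / real m) \<longlonglongrightarrow> \<alpha>"
    using tendsto_add[OF inv a] by (simp add: add_divide_distrib)
  show "(\<lambda>m. real (a m) / real m * ln (real (a m) / real m) - real (a m) / real m) \<longlonglongrightarrow> \<alpha> * ln \<alpha> - \<alpha>"
    using \<alpha> by (intro tendsto_intros a) auto
  show "(\<lambda>m. real (Suc (a m)) / real m * ln (real (Suc (a m)) / real m) + ln (real m) / real m -
      real (a m) / real m) \<longlonglongrightarrow> \<alpha> * ln \<alpha> - \<alpha>"
    using tendsto_diff[OF tendsto_add[OF tendsto_mult[OF a1 tendsto_ln[OF a1]] ln_m] a] \<alpha> by simp
  show "eventually (\<lambda>m. real (a m) / real m * ln (real (a m) / real m) - real (a m) / real m
      \<le> ln (fact (a m)) / real m - real (a m) / real m * ln (real m)) sequentially"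
    using pos m_pos
  proof eventually_elim
    case (elim m)
    hence am: "a m > 0" by (cases "a m") auto
    have "real (a m) / real m * ln (real (a m) / real m) - real (a m) / real m =
        (real (a m) * ln (real (a m)) - real (a m)) / real m - real (a m) / real m * ln (real m)"
      using am elim by (simp add: ln_div diff_divide_distrib right_diff_distrib)
    also have "\<dots> \<le> ln (fact (a m)) / real m - real (a m) / real m * ln (real m)"
      using ln_fact_ge[of "a m"] by (intro diff_right_mono divide_right_mono) auto
    finally show ?case .
  qed
  show "eventually (\<lambda>m. ln (fact (a m)) / real m - real (a m) / real m * ln (real m) \<le>
      real (Suc (a m)) / real m * ln (real (Suc (a m)) / real m) + ln (real m) / real m -
      real (a m) / real m) sequentially"
    using m_pos
  proof eventually_elim
    case (elim m)
    have "ln (fact (a m)) / real m - real (a m) / real m * ln (real m) \<le>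
        (real (Suc (a m)) * ln (real (Suc (a m))) - real (a m)) / real m - real (a m) / real m * ln (real m)"
      using ln_fact_le[of "a m"] by (intro diff_right_mono divide_right_mono) auto
    also have "\<dots> = real (Suc (a m)) / real m * (ln (real (Suc (a m))) - ln (real m)) + ln (real m) / real m -
        real (a m) / real m"
      using elim by (simp add: field_simps)
    also have "ln (real (Suc (a m))) - ln (real m) = ln (real (Suc (a m)) / real m)"
      using elim by (subst ln_div) auto
    finally show ?case .
  qed
qed

text \<open>
  Here \<open>c m\<close> is the number of diagonal steps of a typical Delannoy path from \<open>(0, 0)\<close> to
  \<open>(d m, k m)\<close>. This choice maximizes the growth rate of the multinomial coefficient.
\<close>

lemma tendsto_ln_multinomial:
  fixes d k :: nat
  assumes d: "d > 0" and k: "k > 0"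
  defines "r \<equiv> sqrt (real d ^ 2 + real k ^ 2)"
  obtains c where "\<And>m. c m \<le> d * m" "\<And>m. c m \<le> k * m"
    "(\<lambda>m. (ln (fact (d * m - c m + (k * m - c m) + c m)) - ln (fact (d * m - c m))
      - ln (fact (k * m - c m)) - ln (fact (c m))) / real m)
      \<longlonglongrightarrow> real d * ln ((r + real k) / real d) + real k * ln ((r + real d) / real k)"
proof -
  \<comment> \<open>The smaller root of \<open>\<alpha> * \<beta> = \<gamma> * \<nu>\<close>, the
    equation that expresses the vanishing of the derivative of the growth rate with respect to
    \<open>\<gamma>\<close>.\<close>
  define \<gamma> where "\<gamma> = (real d + real k - r) / 2"
  define c where "c = (\<lambda>m. nat \<lfloor>\<gamma> * real m\<rfloor>)"
  define \<alpha> where "\<alpha> = real d - \<gamma>"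
  define \<beta> where "\<beta> = real k - \<gamma>"
  define \<nu> where "\<nu> = real d + real k - \<gamma>"
  define X where "X = (r + real k) / real d"
  define Y where "Y = (r + real d) / real k"
  have r2: "r\<^sup>2 = (real d)\<^sup>2 + (real k)\<^sup>2" by (simp add: r_def)
  have r0: "r \<ge> 0" by (simp add: r_def)
  have "real d < r" "real k < r"
    unfolding r_def using d k by (auto intro!: real_less_rsqrt)
  moreover have "r < real d + real k"
    unfolding r_def using d k by (intro real_less_lsqrt) (auto simp: power2_sum)
  ultimately have pos: "\<alpha> > 0" "\<beta> > 0" "\<gamma> > 0" "\<nu> > 0" "X > 0" "Y > 0"
    using d k r0 by (auto simp: \<alpha>_def \<beta>_def \<gamma>_def \<nu>_def X_def Y_def)
  have c_le: "real (c m) \<le> \<gamma> * real m" for m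
    unfolding c_def using pos by (intro of_nat_floor) auto
  have c_ge: "\<gamma> * real m - 1 \<le> real (c m)" for m unfolding c_def by linarith
  have cd: "c m \<le> d * m" for m
  proof -
    have "\<gamma> * real m \<le> real d * real m" using pos by (intro mult_right_mono) (auto simp: \<alpha>_def)
    with c_le[of m] have "real (c m) \<le> real (d * m)" by simp
    thus ?thesis by (simp only: of_nat_le_iff)
  qed
  have ck: "c m \<le> k * m" for m
  proof -
    have "\<gamma> * real m \<le> real k * real m" using pos by (intro mult_right_mono) (auto simp: \<beta>_def)
    with c_le[of m] have "real (c m) \<le> real (k * m)" by simp
    thus ?thesis by (simp only: of_nat_le_iff)
  qed
  have lim_c: "(\<lambda>m. real (c m) / real m) \<longlonglongrightarrow> \<gamma>"
  proof (rule tendsto_sandwich)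
    show "(\<lambda>m. \<gamma> - 1 / real m) \<longlonglongrightarrow> \<gamma>"
      using tendsto_diff[OF tendsto_const[of \<gamma>] lim_1_over_n] by simp
    show "(\<lambda>m. \<gamma>) \<longlonglongrightarrow> \<gamma>" by simp
    show "eventually (\<lambda>m. \<gamma> - 1 / real m \<le> real (c m) / real m) sequentially"
      using eventually_gt_at_top[of 0]
      by eventually_elim (use c_ge in \<open>simp add: le_divide_eq left_diff_distrib\<close>)
    show "eventually (\<lambda>m. real (c m) / real m \<le> \<gamma>) sequentially"
      using eventually_gt_at_top[of 0]
      by eventually_elim (use c_le in \<open>simp add: divide_le_eq\<close>)
  qed
  have lin: "(\<lambda>m. real j - real (c m) / real m) \<longlonglongrightarrow> real j - \<gamma>" for j by (intro tendsto_intros lim_c)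
  have lim_a: "(\<lambda>m. real (d * m - c m) / real m) \<longlonglongrightarrow> \<alpha>"
    unfolding \<alpha>_def
    by (rule Lim_transform_eventually[OF lin[of d]], use eventually_gt_at_top[of 0] in eventually_elim)
      (simp add: of_nat_diff[OF cd] diff_divide_distrib)
  have lim_b: "(\<lambda>m. real (k * m - c m) / real m) \<longlonglongrightarrow> \<beta>"
    unfolding \<beta>_def
    by (rule Lim_transform_eventually[OF lin[of k]], use eventually_gt_at_top[of 0] in eventually_elim)
      (simp add: of_nat_diff[OF ck] diff_divide_distrib)
  have lim_n: "(\<lambda>m. real (d * m - c m + (k * m - c m) + c m) / real m) \<longlonglongrightarrow> \<nu>"
    using tendsto_add[OF tendsto_add[OF lim_a lim_b] lim_c]
    by (simp add: add_divide_distrib \<alpha>_def \<beta>_def \<nu>_def)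
  let ?g = "\<lambda>a m. ln (fact (a m)) / real m - real (a m) / real m * ln (real m)"
  let ?f = "\<lambda>m. (ln (fact (d * m - c m + (k * m - c m) + c m)) - ln (fact (d * m - c m))
      - ln (fact (k * m - c m)) - ln (fact (c m))) / real m"
  have "(\<lambda>m. ?g (\<lambda>m. d * m - c m + (k * m - c m) + c m) m - ?g (\<lambda>m. d * m - c m) m
      - ?g (\<lambda>m. k * m - c m) m - ?g c m) \<longlonglongrightarrow>
      (\<nu> * ln \<nu> - \<nu>) - (\<alpha> * ln \<alpha> - \<alpha>) - (\<beta> * ln \<beta> - \<beta>) - (\<gamma> * ln \<gamma> - \<gamma>)"
    using pos by (intro tendsto_diff tendsto_ln_fact lim_a lim_b lim_c lim_n)
  also have "(\<lambda>m. ?g (\<lambda>m. d * m - c m + (k * m - c m) + c m) m - ?g (\<lambda>m. d * m - c m) m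
      - ?g (\<lambda>m. k * m - c m) m - ?g c m) = ?f"
    by (rule ext) (simp add: diff_divide_distrib add_divide_distrib distrib_right)
  also have "(\<nu> * ln \<nu> - \<nu>) - (\<alpha> * ln \<alpha> - \<alpha>) - (\<beta> * ln \<beta> - \<beta>) - (\<gamma> * ln \<gamma> - \<gamma>) =
      real d * ln X + real k * ln Y"
  proof -
    \<comment> \<open>The choice of \<open>\<gamma>\<close> gives
      \<open>\<nu> / \<alpha> = X\<close> and
      \<open>\<nu> / \<beta> = \<alpha> / \<gamma> = Y\<close>. After expressing all logarithms by
      those of \<open>\<nu>\<close>, \<open>X\<close> and \<open>Y\<close>, the terms with
      \<open>ln \<nu>\<close> cancel.\<close>
    have "\<alpha> = \<nu> / X" using d k pos r2
      by (simp add: \<alpha>_def \<nu>_def \<gamma>_def X_def field_simps power2_eq_square)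
    hence \<alpha>: "ln \<alpha> = ln \<nu> - ln X" using pos by (simp add: ln_div)
    have "\<beta> = \<nu> / Y" using d k pos r2
      by (simp add: \<beta>_def \<nu>_def \<gamma>_def Y_def field_simps power2_eq_square)
    hence \<beta>: "ln \<beta> = ln \<nu> - ln Y" using pos by (simp add: ln_div)
    have "\<gamma> = \<alpha> / Y" using d k pos r2
      by (simp add: \<alpha>_def \<gamma>_def Y_def field_simps power2_eq_square)
    hence \<gamma>: "ln \<gamma> = ln \<alpha> - ln Y" using pos by (simp add: ln_div)
    have "\<nu> = \<alpha> + \<beta> + \<gamma>" "real d = \<alpha> + \<gamma>" "real k = \<beta> + \<gamma>" by (simp_all add: \<alpha>_def \<beta>_def \<nu>_def)
    thus ?thesis unfolding \<gamma> \<alpha> \<beta> by (simp add: algebra_simps)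
  qed
  finally have "?f \<longlonglongrightarrow> real d * ln ((r + real k) / real d) + real k * ln ((r + real d) / real k)"
    unfolding X_def Y_def .
  with cd ck that show ?thesis by blast
qed

subsection \<open>The limit\<close>

lemma enat_powr_mono:
  assumes "enat N \<le> M" "a > 0"
  shows "ereal (real N powr a) \<le> enat_powr M a"
  using assms by (cases M) (auto simp: enat_powr_def powr_mono2)

text \<open>It suffices to bound the powers of all positive finite \<open>N\<close> up to
  \<open>M\<close>. For infinite \<open>M\<close> these are unbounded, so \<open>x\<close> is
  infinite as well.\<close>

lemma enat_powr_le_of_bounds:
  assumes a: "a > 0" and M: "M \<ge> 1"
    and bound: "\<And>N. N > 0 \<Longrightarrow> enat N \<le> M \<Longrightarrow> ereal (real N powr a) \<le> x"
  shows "enat_powr M a \<le> x"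
proof (cases M)
  case (enat N)
  thus ?thesis using bound[of N] M by (auto simp: enat_powr_def one_enat_def)
next
  case infinity
  have "x = \<infinity>"
  proof (rule ereal_top)
    fix B :: real
    define N where "N = Suc (nat \<lceil>\<bar>B\<bar> powr (1 / a)\<rceil>)"
    have "\<bar>B\<bar> powr (1 / a) \<le> real N" unfolding N_def by linarith
    hence "(\<bar>B\<bar> powr (1 / a)) powr a \<le> real N powr a" using a by (intro powr_mono2) auto
    hence "B \<le> real N powr a" using a by (auto simp: powr_powr split: if_splits)
    also have "ereal (real N powr a) \<le> x" by (rule bound) (auto simp: N_def infinity)
    finally show "ereal B \<le> x" by simp
  qed
  thus ?thesis by simp
qed

text \<open>Division with remainder: the \<open>(n div n0)\<close>-th power of the given system
  handles the multiple of \<open>n0\<close>, and padding handles the remainder. The resulting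
  exponent \<open>e n\<close> tends to \<open>1 / (d * n0 + k * n0)\<close>.\<close>

lemma realizable_le_liminf:
  assumes d: "d > 0" and n0: "n0 > 0" and N: "N > 0" and real: "realizable (d * n0) (k * n0) N"
  shows "ereal (real N powr (1 / real (d * n0 + k * n0))) \<le>
    liminf (\<lambda>n. enat_powr (Xi (d * n) (k * n)) (1 / real (d * n + k * n)))"
proof -
  define e where "e = (\<lambda>n. real (n div n0) * (1 / real (d * n + k * n)))"
  have div_le: "real (n div n0) \<le> real n / real n0" for n
    using floor_divide_of_nat_eq[of n n0, where 'a = real] by linarith
  have lim_div: "(\<lambda>n. real (n div n0) / real n) \<longlonglongrightarrow> 1 / real n0"
  proof (rule tendsto_sandwich)
    show "(\<lambda>n. 1 / real n0 - 1 / real n) \<longlonglongrightarrow> 1 / real n0"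
      using tendsto_diff[OF tendsto_const[of "1 / real n0"] lim_1_over_n] by simp
    show "(\<lambda>n. 1 / real n0) \<longlonglongrightarrow> 1 / real n0" by simp
    have "real n / real n0 - 1 \<le> real (n div n0)" for n
      using floor_divide_of_nat_eq[of n n0, where 'a = real] by linarith
    thus "eventually (\<lambda>n. 1 / real n0 - 1 / real n \<le> real (n div n0) / real n) sequentially"
      by (intro eventually_mono[OF eventually_gt_at_top[of 0]])
        (simp add: le_divide_eq left_diff_distrib)
    show "eventually (\<lambda>n. real (n div n0) / real n \<le> 1 / real n0) sequentially"
      using div_le
      by (intro eventually_mono[OF eventually_gt_at_top[of 0]]) (simp add: divide_le_eq)
  qed
  have e_eq: "e n = real (n div n0) / real n / real (d + k)" for n
    by (simp add: e_def field_simps)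
  have "e \<longlonglongrightarrow> 1 / real n0 / real (d + k)"
    unfolding e_eq[abs_def] using d by (intro tendsto_divide lim_div tendsto_const) auto
  also have "1 / real n0 / real (d + k) = 1 / real (d * n0 + k * n0)" by (simp add: field_simps)
  finally have "(\<lambda>n. ereal (real N powr e n)) \<longlonglongrightarrow> ereal (real N powr (1 / real (d * n0 + k * n0)))"
    using N by (intro tendsto_ereal tendsto_powr tendsto_const) auto
  hence "ereal (real N powr (1 / real (d * n0 + k * n0))) = liminf (\<lambda>n. ereal (real N powr e n))"
    by (intro lim_imp_Liminf[symmetric]) auto
  also have "\<dots> \<le> liminf (\<lambda>n. enat_powr (Xi (d * n) (k * n)) (1 / real (d * n + k * n)))"
  proof (rule Liminf_mono, rule eventually_mono[OF eventually_gt_at_top[of 0]])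
    fix n :: nat assume n: "n > 0"
    have "realizable (d * n0 * (n div n0) + d * (n mod n0)) (k * n0 * (n div n0) + k * (n mod n0)) (N ^ (n div n0))"
      by (intro realizable_add realizable_power real)
    hence "realizable (d * n) (k * n) (N ^ (n div n0))"
      by (simp add: mult.assoc flip: distrib_left)
    hence "ereal (real (N ^ (n div n0)) powr (1 / real (d * n + k * n))) \<le>
        enat_powr (Xi (d * n) (k * n)) (1 / real (d * n + k * n))"
      using d n by (intro enat_powr_mono) (auto simp: realizable_iff add_pos_nonneg)
    also have "real (N ^ (n div n0)) powr (1 / real (d * n + k * n)) = real N powr e n"
      using N by (simp add: e_def powr_powr flip: powr_realpow)
    finally show "ereal (real N powr e n) \<le> enat_powr (Xi (d * n) (k * n)) (1 / real (d * n + k * n))" .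
  qed
  finally show ?thesis .
qed

text \<open>Fekete's lemma for the supermultiplicative sequence \<open>n \<mapsto> Xi (d * n) (k * n)\<close>.\<close>

lemma realizable_le_xi:
  assumes d: "d > 0" and n0: "n0 > 0" and N: "N > 0" and real: "realizable (d * n0) (k * n0) N"
  shows "ereal (real N powr (1 / real (d * n0 + k * n0))) \<le> xi d k"
proof -
  define c where "c = (\<lambda>n. enat_powr (Xi (d * n) (k * n)) (1 / real (d * n + k * n)))"
  have "c n \<le> liminf c" if n: "n > 0" for n
    unfolding c_def
  proof (rule enat_powr_le_of_bounds)
    show "1 / real (d * n + k * n) > 0" using d n by (simp add: add_pos_nonneg)
    show "Xi (d * n) (k * n) \<ge> 1"
      using realizable_one[of "d * n" "k * n"] by (simp add: realizable_iff one_enat_def)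
  qed (use d n in \<open>auto intro: realizable_le_liminf simp: realizable_iff simp del: of_nat_add of_nat_mult\<close>)
  \<comment> \<open>Each term of positive index is at most the lower limit, so the sequence
    converges in the extended reals and \<open>lim\<close> is this limit.\<close>
  hence "limsup c \<le> liminf c"
    by (intro Limsup_bounded eventually_mono[OF eventually_gt_at_top[of 0]])
  moreover have "liminf c \<le> limsup c" by (rule Liminf_le_Limsup) simp
  ultimately have "c \<longlonglongrightarrow> liminf c" by (subst tendsto_iff_Liminf_eq_Limsup) auto
  hence "xi d k = liminf c" unfolding xi_def c_def[symmetric] by (rule limI)
  thus ?thesis using realizable_le_liminf[OF assms] by (simp add: c_def)
qed

theorem theorem4:
  fixes d k :: nat
  assumes "d > 0" and "k > 0"
  shows "xi d k \<ge>
    ereal (((sqrt (real d ^ 2 + real k ^ 2) + real k) / real d) powr (real d / (2 * (real d + real k)))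
         * ((sqrt (real d ^ 2 + real k ^ 2) + real d) / real k) powr (real k / (2 * (real d + real k))))"
proof -
  define r where "r = sqrt (real d ^ 2 + real k ^ 2)"
  obtain c where c: "\<And>m. c m \<le> d * m" "\<And>m. c m \<le> k * m"
    and lim: "(\<lambda>m. (ln (fact (d * m - c m + (k * m - c m) + c m)) - ln (fact (d * m - c m))
      - ln (fact (k * m - c m)) - ln (fact (c m))) / real m)
      \<longlonglongrightarrow> real d * ln ((r + real k) / real d) + real k * ln ((r + real d) / real k)"
    by (rule tendsto_ln_multinomial[OF assms, folded r_def]) (rule that)
  define f where "f = (\<lambda>m. (ln (fact (d * m - c m + (k * m - c m) + c m)) - ln (fact (d * m - c m))
      - ln (fact (k * m - c m)) - ln (fact (c m))) / real m)"
  have f: "f \<longlonglongrightarrow> real d * ln ((r + real k) / real d) + real k * ln ((r + real d) / real k)"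
    unfolding f_def by (rule lim)
  have bound: "ereal (exp (f m / (2 * (real d + real k)))) \<le> xi d k" if m: "m > 0" for m
  proof -
    have a: "d * m - c m + c m = d * m" and b: "k * m - c m + c m = k * m"
      using c[of m] by simp_all
    have "d * m - c m + c m > 0" using m assms by (simp add: a)
    then obtain N where N: "realizable (2 * (d * m) - 1) (2 * (k * m)) N"
      "N * (fact (d * m - c m) * fact (k * m - c m) * fact (c m)) = fact (d * m - c m + (k * m - c m) + c m)"
      by (rule realizable_multinomial[of _ _ "k * m - c m"]) (simp only: a b)
    have N0: "N > 0" using N(2) by (cases N) auto
    \<comment> \<open>Padding \<open>2 * (d * m) - 1\<close> by one reaches the term
      \<open>n = 2 * m\<close> of the sequence. The doubling stems from the even block lengths and
      produces the factor \<open>2\<close> in the denominators of the exponents.\<close>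
    have "realizable (2 * (d * m) - 1 + 1) (2 * (k * m) + 0) N" by (rule realizable_add) (rule N(1))
    hence "realizable (d * (2 * m)) (k * (2 * m)) N"
      using m assms by (simp add: mult.left_commute)
    hence "ereal (real N powr (1 / real (d * (2 * m) + k * (2 * m)))) \<le> xi d k"
      using m assms N0 by (intro realizable_le_xi) auto
    also have "real N powr (1 / real (d * (2 * m) + k * (2 * m))) = exp (f m / (2 * (real d + real k)))"
    proof -
      have "ln (fact (d * m - c m + (k * m - c m) + c m)) =
          ln (real (N * (fact (d * m - c m) * fact (k * m - c m) * fact (c m))))"
        unfolding N(2) by simp
      also have "\<dots> = ln (real N) + (ln (fact (d * m - c m)) + ln (fact (k * m - c m)) + ln (fact (c m)))"
        using N0 by (simp add: ln_mult)
      finally have "f m = ln (real N) / real m" by (simp add: f_def)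
      moreover have "real (d * (2 * m) + k * (2 * m)) = real m * (2 * (real d + real k))"
        by (simp add: algebra_simps)
      ultimately show ?thesis using N0 by (simp only: powr_def divide_divide_eq_left) simp
    qed
    finally show ?thesis .
  qed
  have X: "(r + real k) / real d > 0" and Y: "(r + real d) / real k > 0"
    using assms by (auto simp: r_def intro!: divide_pos_pos add_nonneg_pos)
  have "(\<lambda>m. ereal (exp (f m / (2 * (real d + real k))))) \<longlonglongrightarrow>
      ereal (exp ((real d * ln ((r + real k) / real d) + real k * ln ((r + real d) / real k)) / (2 * (real d + real k))))"
    using assms by (intro tendsto_intros f) auto
  hence "ereal (exp ((real d * ln ((r + real k) / real d) + real k * ln ((r + real d) / real k)) /
      (2 * (real d + real k)))) \<le> xi d k"
    by (rule Lim_bounded[of _ _ 1]) (use bound in auto)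
  also have "exp ((real d * ln ((r + real k) / real d) + real k * ln ((r + real d) / real k)) / (2 * (real d + real k))) =
      ((r + real k) / real d) powr (real d / (2 * (real d + real k))) *
      ((r + real d) / real k) powr (real k / (2 * (real d + real k)))"
    using X Y by (simp add: powr_def exp_add[symmetric] add_divide_distrib)
  finally show ?thesis unfolding r_def .
qed

end
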